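(* Assume that the linear evolution process $\{L(t,\tau)\colon t\ge\tau\}$ generated by $u_t=A(t)u$ on the Banach space $X$ has exponential splitting with bound $M\ge 1$, exponents $\gamma>\rho$ and projections $\{Q(\tau)\colon\tau\in\mathbb R\}$. Let $\Gamma$ be an admissible norm on $\mathbb R^2$, let $f\colon\mathbb R\times X\to X$ be continuous, with $f(t,0)=0$ for all $t$, satisfying the Lipschitz conditions with constants $L_1,L_2>0$, let $\{T(t,\tau)\colon t\ge\tau\}$ be the evolution process generated by $u_t=A(t)u+f(t,u)$, satisfying the variation of constants formula, and assume that the gap condition $\Gamma\left(\frac{L_1}{\sigma-\rho},\frac{L_2}{\gamma-\sigma}\right)<1$ holds for some $\sigma\in(\rho,\gamma)$. Assume moreover that $f$ is Fréchet differentiable with respect to the second variable with derivative $Df(t,u)\in\mathcal L(X)$, and that $\|Df(t,u)-Df(t,u_0)\|_{\mathcal L(X)}\to0$ as $u\to u_0$ in $X$, for every $t\in\mathbb R$ and $u_0\in X$. Then the derivative with respect to $\eta$ of the function $\Sigma\colon\mathbb R\times X\to X$ that defines the invariant manifold $\mathcal M(t)=\{Q(t)\eta+\Sigma(t,Q(t)\eta)\colon\eta\in X\}$ is continuous: for each $\tau\in\mathbb R$ and $\eta\in X$, $$D_\eta\Sigma(\tau,\eta+h)\to D_\eta\Sigma(\tau,\eta)\ \text{ in }\ \mathcal L(X)\ \text{ as }\ h\to0.$$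
   Context: Setting. $(X,\|\cdot\|)$ is a Banach space, $\mathcal L(X)$ the bounded linear operators on $X$ with the operator norm, $J=\{(t,\tau)\in\mathbb R^2\colon t\ge\tau\}$. A linear evolution process is a family $\{L(t,\tau)\colon(t,\tau)\in J\}\subset\mathcal L(X)$ with $L(t,\tau)=L(t,s)L(s,\tau)$ for $t\ge s\ge\tau$, $L(t,t)=I$, and $J\ni(t,\tau)\mapsto L(t,\tau)\eta\in X$ continuous for each $\eta\in X$. The (possibly unbounded) linear operators $A(t)$, $t\in\mathbb R$, generate such a process: $t\mapsto L(t,\tau)\eta$ is the mild solution of $u_t=A(t)u$, $u(\tau)=\eta$. Exponential splitting with bound $M\ge1$, exponents $\gamma>\rho$ and projections $Q(t)\in\mathcal L(X)$: (i) $Q(t)L(t,\tau)=L(t,\tau)Q(\tau)$ for $t\ge\tau$; (ii) $L(t,\tau)|_{Q(\tau)X}\colon Q(\tau)X\to Q(t)X$ is an isomorphism for $t\ge\tau$, with inverse denoted $L(\tau,t)\colon Q(t)X\to Q(\tau)X$; (iii) $e^{\gamma(t-\tau)}\|L(t,\tau)(I-Q(\tau))\|\le M$ for $t\ge\tau$ and $e^{\rho(t-\tau)}\|L(t,\tau)Q(\tau)\|\le M$ for $t\le\tau$. Norms. $N(\tau)=Q(\tau)X$, $S(\tau)=(I-Q(\tau))X$; $|x|_{N(\tau)}=\sup_{t\le\tau}e^{\rho(t-\tau)}\|L(t,\tau)x\|$ for $x\in N(\tau)$; $|x|_{S(\tau)}=\sup_{t\ge\tau}e^{\gamma(t-\tau)}\|L(t,\tau)x\|$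 for $x\in S(\tau)$. A norm $\Gamma\colon\mathbb R^2\to[0,\infty)$ is admissible if for all $a,b\ge0$ the functions $\Gamma(a,\cdot)$ and $\Gamma(\cdot,b)$ are non-decreasing on $[0,\infty)$. For such $\Gamma$, $\|x\|_\tau=\Gamma(|Q(\tau)x|_{N(\tau)},|(I-Q(\tau))x|_{S(\tau)})$, an equivalent norm on $X$. Lipschitz conditions: for all $t\in\mathbb R$, $u,v\in X$, $|Q(t)(f(t,u)-f(t,v))|_{N(t)}\le L_1\|u-v\|_t$ and $|(I-Q(t))(f(t,u)-f(t,v))|_{S(t)}\le L_2\|u-v\|_t$. Nonlinear process: maps $T(t,\tau)\colon X\to X$, $t\ge\tau$, with $T(t,t)=I$, $T(t,s)T(s,\tau)=T(t,\tau)$ for $t\ge s\ge\tau$, $t\mapsto T(t,\tau)\eta$ continuous on $[\tau,\infty)$, and $T(t,\tau)\eta=L(t,\tau)\eta+\int_\tau^tL(t,s)f(s,T(s,\tau)\eta)\,ds$ for $t\ge\tau$, $\eta\in X$ (variation of constants formula). Fréchet differentiability of $f$: $f(t,u+h)-f(t,u)-Df(t,u)h=\varepsilon(t,u,h)\|h\|_t$ for $t\in\mathbb R$, $u,h\in X$, where $\varepsilon(t,u,h)\to\varepsilon(t,u,0)=0$ as $h\to0$ for each fixed $t,u$. Definition of $\Sigma$. For $\tau\in\mathbb R$ let $E_{\sigma,\tau}=\{z\in C((-\infty,\tau];X)\colon\|z\|_{E_{\sigma,\tau}}=\sup_{t\le\tau}e^{\sigma(t-\tau)}\|z(t)\|_t<\infty\}$.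 For $\eta\in X$ let $z_{\tau,\eta}$ be the unique function in $E_{\sigma,\tau}$ with $$z_{\tau,\eta}(t)=L(t,\tau)Q(\tau)\eta-\int_t^\tau L(t,s)Q(s)f(s,z_{\tau,\eta}(s))\,ds+\int_{-\infty}^tL(t,s)(I-Q(s))f(s,z_{\tau,\eta}(s))\,ds,\quad t\le\tau$$ (it exists and is unique under the gap condition). Then $\Sigma(\tau,\eta)=(I-Q(\tau))z_{\tau,\eta}(\tau)$. If $\{L(t,\tau)\colon t\ge\tau\}$ has exponential splitting with bound $M\ge1$, exponents $\gamma>\rho$ and projections $Q(\tau)$, $\Gamma$ is an admissible norm, $f$ is continuous with $f(t,0)=0$ for all $t\in\mathbb R$, satisfies the Lipschitz conditions with constants $L_1,L_2>0$ and is Fréchet differentiable with respect to the second variable, the process $\{T(t,\tau)\colon t\ge\tau\}$ satisfies the variation of constants formula, and the gap condition $\Gamma\left(\frac{L_1}{\sigma-\rho},\frac{L_2}{\gamma-\sigma}\right)<1$ holds with $\sigma\in(\rho,\gamma)$, then $\Sigma(\tau,\cdot)$ is Fréchet differentiable for every $\tau\in\mathbb R$; $D_\eta\Sigma(\tau,\eta)\in\mathcal L(X)$ is its derivative at $\eta$. *)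

theory Defs
  imports "HOL-Analysis.Analysis"
begin

text \<open>
  Two-parameter families \<open>L t s\<close> and \<open>T t s\<close> are total functions of \<open>t\<close> and \<open>s\<close>, but only their
  values for \<open>s \<le> t\<close> are ever used.
\<close>

definition linear_evolution_process :: "(real \<Rightarrow> real \<Rightarrow> ('a::banach) \<Rightarrow>\<^sub>L 'a) \<Rightarrow> bool" where
  "linear_evolution_process L \<longleftrightarrow>
     (\<forall>t s \<tau>. \<tau> \<le> s \<longrightarrow> s \<le> t \<longrightarrow> L t \<tau> = L t s o\<^sub>L L s \<tau>) \<and>
     (\<forall>t. L t t = id_blinfun) \<and>
     (\<forall>\<eta>. continuous_on {(t, \<tau>). \<tau> \<le> t} (\<lambda>(t, \<tau>). L t \<tau> \<eta>))"

text \<open>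
  The family \<open>L\<close> extended backwards in time: for \<open>t < \<tau>\<close>, the value at \<open>x \<in> range (Q \<tau>)\<close> is the
  preimage of \<open>x\<close> in \<open>range (Q t)\<close> under \<open>L \<tau> t\<close>. For \<open>t < \<tau>\<close> it is meaningful on \<open>range (Q \<tau>)\<close> only.
\<close>

definition ext_process ::
    "(real \<Rightarrow> real \<Rightarrow> ('a::banach) \<Rightarrow>\<^sub>L 'a) \<Rightarrow> (real \<Rightarrow> 'a \<Rightarrow>\<^sub>L 'a) \<Rightarrow> real \<Rightarrow> real \<Rightarrow> 'a \<Rightarrow> 'a" where
  "ext_process L Q t \<tau> x = (if \<tau> \<le> t then L t \<tau> x else inv_into (range (Q t)) (L \<tau> t) x)"

text \<open>
  The homeomorphism clause says that \<open>L t \<tau>\<close> restricts to an isomorphism of normed spaces from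
  \<open>range (Q \<tau>)\<close> onto \<open>range (Q t)\<close>. It makes \<open>x \<mapsto> ext_process L Q t \<tau> (Q \<tau> x)\<close> bounded linear, so
  that the operator norm \<open>onorm\<close> in the last clause is meaningful.
\<close>

definition exponential_splitting ::
    "(real \<Rightarrow> real \<Rightarrow> ('a::banach) \<Rightarrow>\<^sub>L 'a) \<Rightarrow> (real \<Rightarrow> 'a \<Rightarrow>\<^sub>L 'a) \<Rightarrow> real \<Rightarrow> real \<Rightarrow> real \<Rightarrow> bool" where
  "exponential_splitting L Q M \<gamma> \<rho> \<longleftrightarrow>
     1 \<le> M \<and> \<rho> < \<gamma> \<and>
     (\<forall>t. Q t o\<^sub>L Q t = Q t) \<and>
     (\<forall>t \<tau>. \<tau> \<le> t \<longrightarrow> Q t o\<^sub>L L t \<tau> = L t \<tau> o\<^sub>L Q \<tau>) \<and>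
     (\<forall>t \<tau>. \<tau> \<le> t \<longrightarrow>
        homeomorphism (range (Q \<tau>)) (range (Q t)) (L t \<tau>) (ext_process L Q \<tau> t)) \<and>
     (\<forall>t \<tau>. \<tau> \<le> t \<longrightarrow> exp (\<gamma> * (t - \<tau>)) * norm (L t \<tau> o\<^sub>L (id_blinfun - Q \<tau>)) \<le> M) \<and>
     (\<forall>t \<tau>. t \<le> \<tau> \<longrightarrow> exp (\<rho> * (t - \<tau>)) * onorm (\<lambda>x. ext_process L Q t \<tau> (Q \<tau> x)) \<le> M)"

definition norm_N ::
    "(real \<Rightarrow> real \<Rightarrow> ('a::banach) \<Rightarrow>\<^sub>L 'a) \<Rightarrow> (real \<Rightarrow> 'a \<Rightarrow>\<^sub>L 'a) \<Rightarrow> real \<Rightarrow> real \<Rightarrow> 'a \<Rightarrow> real" where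
  "norm_N L Q \<rho> \<tau> x = (SUP t\<in>{..\<tau>}. exp (\<rho> * (t - \<tau>)) * norm (ext_process L Q t \<tau> x))"

definition norm_S ::
    "(real \<Rightarrow> real \<Rightarrow> ('a::banach) \<Rightarrow>\<^sub>L 'a) \<Rightarrow> real \<Rightarrow> real \<Rightarrow> 'a \<Rightarrow> real" where
  "norm_S L \<gamma> \<tau> x = (SUP t\<in>{\<tau>..}. exp (\<gamma> * (t - \<tau>)) * norm (L t \<tau> x))"

definition admissible_norm :: "(real \<times> real \<Rightarrow> real) \<Rightarrow> bool" where
  "admissible_norm \<Gamma> \<longleftrightarrow>
     (\<forall>v. 0 \<le> \<Gamma> v) \<and> (\<forall>v. \<Gamma> v = 0 \<longleftrightarrow> v = 0) \<and>
     (\<forall>c v. \<Gamma> (c *\<^sub>R v) = \<bar>c\<bar> * \<Gamma> v) \<and>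
     (\<forall>v w. \<Gamma> (v + w) \<le> \<Gamma> v + \<Gamma> w) \<and>
     (\<forall>a\<ge>0. mono_on {0..} (\<lambda>b. \<Gamma> (a, b))) \<and>
     (\<forall>b\<ge>0. mono_on {0..} (\<lambda>a. \<Gamma> (a, b)))"

definition norm_at ::
    "(real \<Rightarrow> real \<Rightarrow> ('a::banach) \<Rightarrow>\<^sub>L 'a) \<Rightarrow> (real \<Rightarrow> 'a \<Rightarrow>\<^sub>L 'a) \<Rightarrow> real \<Rightarrow> real \<Rightarrow>
     (real \<times> real \<Rightarrow> real) \<Rightarrow> real \<Rightarrow> 'a \<Rightarrow> real" where
  "norm_at L Q \<gamma> \<rho> \<Gamma> \<tau> x =
     \<Gamma> (norm_N L Q \<rho> \<tau> (Q \<tau> x), norm_S L \<gamma> \<tau> ((id_blinfun - Q \<tau>) x))"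

definition lipschitz_conditions ::
    "(real \<Rightarrow> real \<Rightarrow> ('a::banach) \<Rightarrow>\<^sub>L 'a) \<Rightarrow> (real \<Rightarrow> 'a \<Rightarrow>\<^sub>L 'a) \<Rightarrow> real \<Rightarrow> real \<Rightarrow>
     (real \<times> real \<Rightarrow> real) \<Rightarrow> (real \<Rightarrow> 'a \<Rightarrow> 'a) \<Rightarrow> real \<Rightarrow> real \<Rightarrow> bool" where
  "lipschitz_conditions L Q \<gamma> \<rho> \<Gamma> f L1 L2 \<longleftrightarrow>
     (\<forall>t u v. norm_N L Q \<rho> t (Q t (f t u - f t v)) \<le> L1 * norm_at L Q \<gamma> \<rho> \<Gamma> t (u - v)) \<and>
     (\<forall>t u v. norm_S L \<gamma> t ((id_blinfun - Q t) (f t u - f t v))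
                \<le> L2 * norm_at L Q \<gamma> \<rho> \<Gamma> t (u - v))"

definition evolution_process :: "(real \<Rightarrow> real \<Rightarrow> 'a::banach \<Rightarrow> 'a) \<Rightarrow> bool" where
  "evolution_process T \<longleftrightarrow>
     (\<forall>t \<eta>. T t t \<eta> = \<eta>) \<and>
     (\<forall>t s \<tau> \<eta>. \<tau> \<le> s \<longrightarrow> s \<le> t \<longrightarrow> T t s (T s \<tau> \<eta>) = T t \<tau> \<eta>) \<and>
     (\<forall>\<tau> \<eta>. continuous_on {\<tau>..} (\<lambda>t. T t \<tau> \<eta>))"

definition variation_of_constants ::
    "(real \<Rightarrow> real \<Rightarrow> ('a::banach) \<Rightarrow>\<^sub>L 'a) \<Rightarrow> (real \<Rightarrow> 'a \<Rightarrow> 'a) \<Rightarrow>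
     (real \<Rightarrow> real \<Rightarrow> 'a \<Rightarrow> 'a) \<Rightarrow> bool" where
  "variation_of_constants L f T \<longleftrightarrow>
     (\<forall>t \<tau> \<eta>. \<tau> \<le> t \<longrightarrow>
        T t \<tau> \<eta> = L t \<tau> \<eta> + integral {\<tau>..t} (\<lambda>s. L t s (f s (T s \<tau> \<eta>))))"

text \<open>
  Functions on \<open>{..\<tau>}\<close> are represented as total functions in \<open>extensional {..\<tau>}\<close>, so that equality
  on \<open>{..\<tau>}\<close> is equality and the description in \<open>backward_orbit\<close> can be unique.
\<close>

definition E_space ::
    "(real \<Rightarrow> real \<Rightarrow> ('a::banach) \<Rightarrow>\<^sub>L 'a) \<Rightarrow> (real \<Rightarrow> 'a \<Rightarrow>\<^sub>L 'a) \<Rightarrow> real \<Rightarrow> real \<Rightarrow>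
     (real \<times> real \<Rightarrow> real) \<Rightarrow> real \<Rightarrow> real \<Rightarrow> (real \<Rightarrow> 'a) set" where
  "E_space L Q \<gamma> \<rho> \<Gamma> \<sigma> \<tau> =
     {z \<in> extensional {..\<tau>}. continuous_on {..\<tau>} z \<and>
        bdd_above ((\<lambda>t. exp (\<sigma> * (t - \<tau>)) * norm_at L Q \<gamma> \<rho> \<Gamma> t (z t)) ` {..\<tau>})}"

definition backward_orbit ::
    "(real \<Rightarrow> real \<Rightarrow> ('a::banach) \<Rightarrow>\<^sub>L 'a) \<Rightarrow> (real \<Rightarrow> 'a \<Rightarrow>\<^sub>L 'a) \<Rightarrow> real \<Rightarrow> real \<Rightarrow>
     (real \<times> real \<Rightarrow> real) \<Rightarrow> (real \<Rightarrow> 'a \<Rightarrow> 'a) \<Rightarrow> real \<Rightarrow> real \<Rightarrow> 'a \<Rightarrow> real \<Rightarrow> 'a" where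
  "backward_orbit L Q \<gamma> \<rho> \<Gamma> f \<sigma> \<tau> \<eta> =
     (THE z. z \<in> E_space L Q \<gamma> \<rho> \<Gamma> \<sigma> \<tau> \<and>
        (\<forall>t\<le>\<tau>. z t = ext_process L Q t \<tau> (Q \<tau> \<eta>)
             - integral {t..\<tau>} (\<lambda>s. ext_process L Q t s (Q s (f s (z s))))
             + integral {..t} (\<lambda>s. L t s ((id_blinfun - Q s) (f s (z s))))))"

definition manifold_map ::
    "(real \<Rightarrow> real \<Rightarrow> ('a::banach) \<Rightarrow>\<^sub>L 'a) \<Rightarrow> (real \<Rightarrow> 'a \<Rightarrow>\<^sub>L 'a) \<Rightarrow> real \<Rightarrow> real \<Rightarrow>
     (real \<times> real \<Rightarrow> real) \<Rightarrow> (real \<Rightarrow> 'a \<Rightarrow> 'a) \<Rightarrow> real \<Rightarrow> real \<Rightarrow> 'a \<Rightarrow> 'a" where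
  "manifold_map L Q \<gamma> \<rho> \<Gamma> f \<sigma> \<tau> \<eta> =
     (id_blinfun - Q \<tau>) (backward_orbit L Q \<gamma> \<rho> \<Gamma> f \<sigma> \<tau> \<eta> \<tau>)"

end

theory Submission
  imports Defs
begin

text \<open>
  A Lipschitz map is \<open>C\<^sup>1\<close> as soon as its difference quotients
  \<open>(g (u + s h) - g u) / s\<close> are Cauchy as \<open>u \<rightarrow> \<eta>\<close> and \<open>s \<rightarrow> 0\<close>, uniformly for bounded \<open>h\<close>. Two difference
  quotients \<open>w\<close>, \<open>w'\<close> of the backward orbits in the same direction satisfy \<open>w - w' = K (A w - A w' + e)\<close>;
  here \<open>A w\<close> is the difference quotient of \<open>f\<close> in the direction \<open>w\<close> and \<open>K\<close> the integral operator of the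
  orbit equation. The linear part cancels, \<open>K A\<close> is Lipschitz with the constant of the gap condition, and the
  remainder \<open>e\<close> tends to \<open>0\<close> pointwise because \<open>f t\<close> is strictly differentiable. The gap condition is
  open, so the orbits also live in the smaller space with an exponent \<open>\<sigma>' < \<sigma>\<close>; this dominates \<open>e\<close>, and
  dominated convergence for the real function \<open>norm e\<close> finishes the argument. Working with quotients
  instead of the variational equation avoids integrating \<open>s \<mapsto> Df s (z s)\<close>, which need not be
  continuous in \<open>s\<close>.
\<close>

section \<open>Calculus\<close>

text \<open>At a fixed time \<open>r\<close> the remainder \<open>e\<close> tends to zero, but
  uniformity in \<open>r\<close> is out of reach, because \<open>Df\<close> is assumed continuous
  only in its second argument. A supremum over time therefore need not tend to zero, and the
  estimate for \<open>K\<close> has to accept a weighted integral of the remainder. The weight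
  \<open>exp (\<sigma> * (r - \<tau>))\<close> makes growth of order
  \<open>exp (\<sigma>' * (\<tau> - r))\<close> integrable; this is the use of the second exponent.
  Directions are merely bounded, without any compactness, so the limit at each time must be uniform
  over them, which continuity of \<open>Df\<close> in operator norm provides. The linear part
  cancels because it is \<open>P r \<tau> h\<close>, which involves neither base point nor step.
  Uniformity over base points, steps and directions is proved by contradiction, since dominated
  convergence speaks of sequences.\<close>

lemma has_integral_exp_Iic:
  fixes a c :: real
  assumes "a > 0"
  shows "((\<lambda>x. exp (a * x)) has_integral exp (a * c) / a) {..c}"
proof -
  have "(\<lambda>x. exp (-a * x)) absolutely_integrable_on {-c..} \<and>
      integral {-c..} (\<lambda>x. exp (-a * x)) = exp (a * c) / a"
    using has_integral_exp_minus_to_infinity[OF assms, of "-c"]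
    by (auto simp: has_integral_iff intro!: nonnegative_absolutely_integrable_1)
  then have "(\<lambda>x. exp (-a * - x)) absolutely_integrable_on {..c} \<and>
      integral {..c} (\<lambda>x. exp (-a * - x)) = exp (a * c) / a"
    by (subst has_absolute_integral_reflect_real[where B="{-c..}"]) auto
  then show ?thesis
    by (auto simp: has_integral_iff absolutely_integrable_on_def)
qed

text \<open>Comparison test on a left half line: continuity gives integrability on bounded
  intervals, and the real majorant \<open>h\<close> controls the tail.\<close>

lemma integrable_Iic_continuous_bound:
  fixes g :: "real \<Rightarrow> 'b::banach"
  assumes g: "continuous_on {..t} g" and le: "\<And>s. s \<le> t \<Longrightarrow> norm (g s) \<le> h s"
    and h: "h integrable_on {..t}"
  shows "g integrable_on {..t}"
proof (rule integrable_on_all_intervals_integrable_bound[OF _ _ h])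
  fix a b :: real
  have "g integrable_on {a..min b t}"
    by (rule integrable_continuous_interval) (rule continuous_on_subset[OF g], auto)
  moreover have "{a..min b t} = {..t} \<inter> {a..b}" by auto
  ultimately show "(\<lambda>x. if x \<in> {..t} then g x else 0) integrable_on cbox a b"
    by (simp only: integrable_restrict_Int cbox_interval)
qed (use le in auto)

text \<open>Passes between the definitions, where the weight multiplies the norm, and the form used
  in the estimates, with the inverse weight on the right.\<close>

lemma exp_mult_le_iff:
  fixes a t s x c :: real
  shows "exp (a * (t - s)) * x \<le> c \<longleftrightarrow> x \<le> c * exp (a * (s - t))"
proof -
  have "exp (a * (s - t)) = inverse (exp (a * (t - s)))"
    by (simp add: algebra_simps flip: exp_minus)
  then show ?thesis by (simp add: divide_inverse[symmetric] pos_le_divide_eq mult.commute)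
qed

section \<open>Continuity criteria\<close>

lemma continuous_on_Iic:
  fixes F :: "real \<Rightarrow> 'b::topological_space"
  assumes "\<And>a. a < \<tau> \<Longrightarrow> continuous_on {a..\<tau>} F"
  shows "continuous_on {..\<tau>} F"
  unfolding continuous_on_eq_continuous_within
proof
  fix t assume t: "t \<in> {..\<tau>}"
  have "continuous (at t within {t - 1..\<tau>}) F"
    using assms[of "t - 1"] t by (auto simp: continuous_on_eq_continuous_within)
  moreover have "at t within {t - 1..\<tau>} = at t within {..\<tau>}"
    by (rule at_within_nhd[of _ "{t - 1<..}"]) auto
  ultimately show "continuous (at t within {..\<tau>}) F" by simp
qed

text \<open>Only strong continuity of \<open>A\<close> is at hand, not continuity in operator norm.
  Splitting \<open>A s (g s)\<close> into \<open>A s (g s - g s0)\<close> and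
  \<open>A s (g s0)\<close> leaves the norm bound for the first summand and strong continuity for
  the second.\<close>

lemma continuous_on_blinfun_family:
  fixes A :: "'c::metric_space \<Rightarrow> 'a::real_normed_vector \<Rightarrow>\<^sub>L 'b::real_normed_vector"
  assumes bd: "\<And>s. s \<in> S \<Longrightarrow> norm (A s) \<le> b s" and b: "continuous_on S b"
    and A: "\<And>x. continuous_on S (\<lambda>s. A s x)" and g: "continuous_on S g"
  shows "continuous_on S (\<lambda>s. A s (g s))"
  unfolding continuous_on_def
proof
  fix s0 assume s0: "s0 \<in> S"
  let ?F = "at s0 within S"
  have bt: "(b \<longlongrightarrow> b s0) ?F" and gt: "(g \<longlongrightarrow> g s0) ?F"
    using b g s0 by (auto simp: continuous_on_def)
  have "((\<lambda>s. A s (g s - g s0)) \<longlongrightarrow> 0) ?F"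
  proof (rule Lim_null_comparison)
    show "\<forall>\<^sub>F s in ?F. norm (A s (g s - g s0)) \<le> b s * norm (g s - g s0)"
      unfolding eventually_at_filter
      by (rule always_eventually)
        (use bd norm_blinfun order_trans mult_right_mono norm_ge_zero in meson)
    have "((\<lambda>s. b s * norm (g s - g s0)) \<longlongrightarrow> b s0 * norm (g s0 - g s0)) ?F"
      by (intro tendsto_intros bt gt)
    then show "((\<lambda>s. b s * norm (g s - g s0)) \<longlongrightarrow> 0) ?F" by simp
  qed
  moreover have "((\<lambda>s. A s (g s0)) \<longlongrightarrow> A s0 (g s0)) ?F"
    using A s0 by (auto simp: continuous_on_def)
  ultimately have "((\<lambda>s. A s (g s - g s0) + A s (g s0)) \<longlongrightarrow> 0 + A s0 (g s0)) ?F"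
    by (rule tendsto_add)
  then show "((\<lambda>s. A s (g s)) \<longlongrightarrow> A s0 (g s0)) ?F"
    by (simp add: blinfun.diff_right)
qed

text \<open>The approximant and its neighbourhood may depend on the point and on the tolerance. This
  suits improper integrals that are cut off close to the point considered.\<close>

lemma continuous_on_local_approx:
  fixes F :: "'c::metric_space \<Rightarrow> 'b::metric_space"
  assumes "\<And>x e. x \<in> S \<Longrightarrow> e > 0 \<Longrightarrow> \<exists>h d. d > 0 \<and> continuous_on (S \<inter> ball x d) h \<and>
      (\<forall>y\<in>S. dist y x < d \<longrightarrow> dist (F y) (h y) \<le> e)"
  shows "continuous_on S F"
  unfolding continuous_on_iff
proof (intro ballI allI impI)
  fix x and e :: real assume x: "x \<in> S" and e: "0 < e"
  obtain h d where d: "d > 0" "continuous_on (S \<inter> ball x d) h"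
    "\<And>y. y\<in>S \<Longrightarrow> dist y x < d \<Longrightarrow> dist (F y) (h y) \<le> e/4"
    using assms[OF x, of "e/4"] e by auto
  obtain d' where d': "d' > 0"
    "\<And>y. y\<in>S \<inter> ball x d \<Longrightarrow> dist y x < d' \<Longrightarrow> dist (h y) (h x) < e/4"
    using d(2)[unfolded continuous_on_iff, rule_format, of x "e/4"] e x d(1) by auto
  show "\<exists>d>0. \<forall>x'\<in>S. dist x' x < d \<longrightarrow> dist (F x') (F x) < e"
  proof (intro exI[of _ "min d d'"] conjI ballI impI)
    fix y assume y: "y \<in> S" "dist y x < min d d'"
    have "dist (F y) (h y) \<le> e/4" "dist (F x) (h x) \<le> e/4" "dist (h y) (h x) < e/4"
      using d(3)[of y] d(3)[of x] d(1) d'(2)[of y] x y by (simp_all add: dist_commute)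
    then show "dist (F y) (F x) < e"
      using dist_triangle[of "F y" "F x" "h y"] dist_triangle[of "h y" "F x" "h x"]
        dist_commute[of "h x" "F x"] e by linarith
  qed (use d(1) d'(1) in simp)
qed

text \<open>Rescaling a vector to norm \<open>d / 2\<close> turns continuity at zero into the
  operator bound \<open>2 / d\<close>. It is meant for the backward evolution, whose continuity
  comes from a homeomorphism.\<close>

lemma bounded_linear_continuous_at_0:
  fixes F :: "'a::real_normed_vector \<Rightarrow> 'b::real_normed_vector"
  assumes "linear F" and "isCont F 0"
  shows "bounded_linear F"
proof -
  interpret linear F by fact
  obtain d where d: "d > 0" "\<And>x. norm x < d \<Longrightarrow> norm (F x) < 1"
    using assms(2)[unfolded continuous_at_eps_delta, rule_format, of 1]
    by (auto simp: zero)
  have "norm (F x) \<le> norm x * (2 / d)" for x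
  proof (cases "x = 0")
    case False
    have "norm (F ((d / (2 * norm x)) *\<^sub>R x)) < 1"
      using d False by (intro d(2)) auto
    then show ?thesis
      using d False by (simp add: scale field_simps)
  qed (simp add: zero)
  then show ?thesis
    by (intro bounded_linear_intro[where K="2/d"]) (auto simp: add scale)
qed

text \<open>The supremum of \<open>m\<close> is itself an admissible \<open>c\<close>, hence at most
  \<open>q\<close> times itself plus \<open>r\<close>. Its finiteness, known beforehand, allows
  solving for it.\<close>

lemma bounded_contraction_bound:
  fixes m :: "'c \<Rightarrow> real"
  assumes bd: "bdd_above (m ` S)" and q: "q < 1" and pos: "\<And>t. t \<in> S \<Longrightarrow> 0 \<le> m t"
    and step: "\<And>c. 0 \<le> c \<Longrightarrow> (\<And>t. t \<in> S \<Longrightarrow> m t \<le> c) \<Longrightarrow> (\<And>t. t \<in> S \<Longrightarrow> m t \<le> q * c + r)"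
    and t: "t \<in> S"
  shows "m t \<le> r / (1 - q)"
proof -
  let ?c = "SUP t\<in>S. m t"
  have le: "m t \<le> ?c" if "t \<in> S" for t
    using bd that by (rule cSUP_upper2[OF _ _ order_refl])
  have "0 \<le> ?c" using le[OF t] pos[OF t] by simp
  then have "?c \<le> q * ?c + r"
    using t by (intro cSUP_least step le) auto
  then have "?c \<le> r / (1 - q)" using q by (simp add: field_simps)
  then show ?thesis using le[OF t] by simp
qed

text \<open>Mean value inequality for \<open>F - DF u0\<close> on a ball where \<open>DF\<close>
  stays \<open>e\<close>-close to \<open>DF u0\<close>. Both points may move, which a bare
  derivative at \<open>u0\<close> would not allow.\<close>

lemma has_derivative_strict:
  fixes F :: "'a::real_normed_vector \<Rightarrow> 'b::real_normed_vector" and DF :: "'a \<Rightarrow> 'a \<Rightarrow>\<^sub>L 'b"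
  assumes der: "\<And>u. (F has_derivative blinfun_apply (DF u)) (at u)"
    and cont: "((\<lambda>u. norm (DF u - DF u0)) \<longlongrightarrow> 0) (at u0)" and e: "e > 0"
  obtains d where "d > 0"
    "\<And>u v. norm (u - u0) < d \<Longrightarrow> norm (v - u0) < d \<Longrightarrow>
       norm (F v - F u - DF u0 (v - u)) \<le> e * norm (v - u)"
proof -
  obtain d where d: "d > 0" "\<And>u. u \<noteq> u0 \<Longrightarrow> dist u u0 < d \<Longrightarrow> norm (DF u - DF u0) < e"
    using tendstoD[OF cont e] unfolding eventually_at by auto
  have d': "norm (DF u - DF u0) \<le> e" if "dist u u0 < d" for u
    using d(2)[of u] that e by (cases "u = u0") auto
  show ?thesis
  proof (rule that[OF d(1)])
    fix u v assume "norm (u - u0) < d" "norm (v - u0) < d"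
    then have uv: "u \<in> ball u0 d" "v \<in> ball u0 d" by (auto simp: dist_norm norm_minus_commute)
    have "norm (F v - F u - DF u0 (v - u)) \<le> norm (v - u) * e"
    proof (rule differentiable_bound_linearization[where S="ball u0 d"])
      fix t :: real assume "t \<in> {0..1}"
      then have "(1 - t) *\<^sub>R u + t *\<^sub>R v \<in> ball u0 d"
        using uv by (intro convexD_alt[OF convex_ball]) auto
      then show "u + t *\<^sub>R (v - u) \<in> ball u0 d" by (simp add: algebra_simps)
    next
      fix x assume "x \<in> ball u0 d"
      then have "norm (DF x - DF u0) \<le> e" by (intro d') (auto simp: dist_commute)
      then show "onorm (blinfun_apply (DF x) - blinfun_apply (DF u0)) \<le> e"
        by (simp add: norm_blinfun.rep_eq minus_blinfun.rep_eq fun_diff_def)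
    qed (use der d in \<open>auto intro: has_derivative_at_withinI\<close>)
    then show "norm (F v - F u - DF u0 (v - u)) \<le> e * norm (v - u)" by (simp add: mult.commute)
  qed
qed

text \<open>Letting one of the two steps tend to zero compares quotients with the limit
  \<open>D\<close>, uniformly in base point, step and direction. With the base point fixed this is
  differentiability, with the base point moving it is continuity of the derivative; the Lipschitz
  constant bounds \<open>D\<close>.\<close>

lemma C1_if_difference_quotients_Cauchy:
  fixes g :: "'a::real_normed_vector \<Rightarrow> 'b::banach"
  assumes lip: "\<And>u v. norm (g u - g v) \<le> C * norm (u - v)"
    and cauchy: "\<And>\<eta> R \<epsilon>. \<epsilon> > 0 \<Longrightarrow> \<exists>d>0. \<forall>u v h s t.
        norm (u - \<eta>) < d \<longrightarrow> norm (v - \<eta>) < d \<longrightarrow> s \<noteq> 0 \<longrightarrow> \<bar>s\<bar> < d \<longrightarrow> t \<noteq> 0 \<longrightarrow> \<bar>t\<bar> < d \<longrightarrow>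
        norm h \<le> R \<longrightarrow>
        norm ((g (u + s *\<^sub>R h) - g u) /\<^sub>R s - (g (v + t *\<^sub>R h) - g v) /\<^sub>R t) \<le> \<epsilon>"
  shows "\<exists>D :: 'a \<Rightarrow> 'a \<Rightarrow>\<^sub>L 'b. \<forall>\<eta>.
      (g has_derivative blinfun_apply (D \<eta>)) (at \<eta>) \<and> ((\<lambda>h. D (\<eta> + h)) \<longlongrightarrow> D \<eta>) (at 0)"
proof -
  define q where "q t u h = (g (u + t *\<^sub>R h) - g u) /\<^sub>R t" for t u h
  define r :: "nat \<Rightarrow> real" where "r n = 1 / (real n + 1)" for n
  have r: "r n \<noteq> 0" "r n > 0" for n by (auto simp: r_def)
  have r0: "r \<longlonglongrightarrow> 0" unfolding r_def by real_asymp
  have r_small: "\<forall>\<^sub>F n in sequentially. \<bar>r n\<bar> < d" if "d > 0" for d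
    using tendstoD[OF r0 that] by (simp add: dist_norm)
  define D where "D \<eta> h = lim (\<lambda>n. q (r n) \<eta> h)" for \<eta> h
  have conv: "(\<lambda>n. q (r n) \<eta> h) \<longlonglongrightarrow> D \<eta> h" for \<eta> h
  proof -
    have "Cauchy (\<lambda>n. q (r n) \<eta> h)"
    proof (rule metric_CauchyI)
      fix e :: real assume e: "e > 0"
      obtain d where d: "d > 0" "\<And>s t. s \<noteq> 0 \<Longrightarrow> \<bar>s\<bar> < d \<Longrightarrow> t \<noteq> 0 \<Longrightarrow> \<bar>t\<bar> < d \<Longrightarrow>
          norm (q s \<eta> h - q t \<eta> h) \<le> e/2"
        using cauchy[of "e/2" \<eta> "norm h"] e unfolding q_def by fastforce
      obtain N where "\<And>n. n \<ge> N \<Longrightarrow> \<bar>r n\<bar> < d"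
        using r_small[OF d(1)] by (auto simp: eventually_sequentially)
      then have "norm (q (r m) \<eta> h - q (r n) \<eta> h) \<le> e/2" if "m \<ge> N" "n \<ge> N" for m n
        using that by (intro d(2) r)
      then have "\<forall>m\<ge>N. \<forall>n\<ge>N. dist (q (r m) \<eta> h) (q (r n) \<eta> h) < e"
        using e by (auto simp: dist_norm intro: le_less_trans[of _ "e/2"])
      then show "\<exists>N. \<forall>m\<ge>N. \<forall>n\<ge>N. dist (q (r m) \<eta> h) (q (r n) \<eta> h) < e" by blast
    qed
    then show ?thesis unfolding D_def by (simp add: Cauchy_convergent convergent_LIMSEQ_iff[symmetric])
  qed
  have unif: "\<exists>d>0. \<forall>u h s. norm (u - \<eta>) < d \<longrightarrow> s \<noteq> 0 \<longrightarrow> \<bar>s\<bar> < d \<longrightarrow> norm h \<le> R \<longrightarrow>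
      norm (q s u h - D \<eta> h) \<le> \<epsilon>" if e: "\<epsilon> > 0" for \<epsilon> \<eta> R
  proof -
    obtain d where d: "d > 0" "\<And>u v h s t.
        norm (u - \<eta>) < d \<Longrightarrow> norm (v - \<eta>) < d \<Longrightarrow> s \<noteq> 0 \<Longrightarrow> \<bar>s\<bar> < d \<Longrightarrow> t \<noteq> 0 \<Longrightarrow> \<bar>t\<bar> < d \<Longrightarrow>
        norm h \<le> R \<Longrightarrow> norm (q s u h - q t v h) \<le> \<epsilon>"
      using cauchy[OF e, of \<eta> R] unfolding q_def by blast
    have "norm (q s u h - D \<eta> h) \<le> \<epsilon>"
      if "norm (u - \<eta>) < d" "s \<noteq> 0" "\<bar>s\<bar> < d" "norm h \<le> R" for u h s
    proof (rule Lim_norm_ubound[OF sequentially_bot])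
      show "(\<lambda>n. q s u h - q (r n) \<eta> h) \<longlonglongrightarrow> q s u h - D \<eta> h"
        by (intro tendsto_intros conv)
      show "\<forall>\<^sub>F n in sequentially. norm (q s u h - q (r n) \<eta> h) \<le> \<epsilon>"
        using r_small[OF d(1)] by eventually_elim (use that d r in auto)
    qed
    with d(1) show ?thesis by blast
  qed
  \<comment> \<open>The base point may move together with the step, as additivity of
    \<open>D \<eta>\<close> requires.\<close>
  have limq: "(\<lambda>n. q (s n) (u n) h) \<longlonglongrightarrow> D \<eta> h"
    if s: "s \<longlonglongrightarrow> 0" "\<And>n. s n \<noteq> 0" and u: "u \<longlonglongrightarrow> \<eta>" for s u h \<eta>
  proof (rule tendstoI)
    fix e :: real assume e: "e > 0"
    obtain d where d: "d > 0" "\<And>u s. norm (u - \<eta>) < d \<Longrightarrow> s \<noteq> 0 \<Longrightarrow> \<bar>s\<bar> < d \<Longrightarrow>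
      norm (q s u h - D \<eta> h) \<le> e/2"
      using unif[of "e/2" \<eta> "norm h"] e by auto
    have "\<forall>\<^sub>F n in sequentially. norm (u n - \<eta>) < d" "\<forall>\<^sub>F n in sequentially. \<bar>s n\<bar> < d"
      using tendstoD[OF u d(1)] tendstoD[OF s(1) d(1)] by (auto simp: dist_norm)
    then show "\<forall>\<^sub>F n in sequentially. dist (q (s n) (u n) h) (D \<eta> h) < e"
      by eventually_elim
        (use d(2) s(2) e in \<open>auto simp: dist_norm intro: le_less_trans[of _ "e/2"]\<close>)
  qed
  have add: "D \<eta> (h + k) = D \<eta> h + D \<eta> k" for \<eta> h k
  proof (rule LIMSEQ_unique[OF conv])
    \<comment> \<open>The increment along \<open>h + k\<close> is the one along \<open>k\<close>
      from \<open>\<eta>\<close>, followed by the one along \<open>h\<close> from the shifted base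
      point.\<close>
    have "(\<lambda>n. \<eta> + r n *\<^sub>R k) \<longlonglongrightarrow> \<eta> + 0 *\<^sub>R k" by (intro tendsto_intros r0)
    then have "(\<lambda>n. q (r n) (\<eta> + r n *\<^sub>R k) h + q (r n) \<eta> k) \<longlonglongrightarrow> D \<eta> h + D \<eta> k"
      using r by (intro tendsto_add limq r0 conv) auto
    moreover have "q (r n) (\<eta> + r n *\<^sub>R k) h + q (r n) \<eta> k = q (r n) \<eta> (h + k)" for n
      unfolding q_def by (simp add: algebra_simps)
    ultimately show "(\<lambda>n. q (r n) \<eta> (h + k)) \<longlonglongrightarrow> D \<eta> h + D \<eta> k" by simp
  qed
  have scale: "D \<eta> (c *\<^sub>R h) = c *\<^sub>R D \<eta> h" for \<eta> h c
  proof (cases "c = 0")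
    case True
    have "D \<eta> 0 = 0" using add[of \<eta> 0 0] by simp
    then show ?thesis using True by simp
  next
    case False
    show ?thesis
    proof (rule LIMSEQ_unique[OF conv])
      \<comment> \<open>A step \<open>r n\<close> along \<open>c *\<^sub>R h\<close> is a step
        \<open>c * r n\<close> along \<open>h\<close>.\<close>
      have "(\<lambda>n. c * r n) \<longlonglongrightarrow> c * 0" by (intro tendsto_intros r0)
      then have "(\<lambda>n. c *\<^sub>R q (c * r n) \<eta> h) \<longlonglongrightarrow> c *\<^sub>R D \<eta> h"
        using r False by (intro tendsto_scaleR tendsto_const limq) auto
      moreover have "c *\<^sub>R q (c * r n) \<eta> h = q (r n) \<eta> (c *\<^sub>R h)" for n
        unfolding q_def using False by (simp add: ac_simps)
      ultimately show "(\<lambda>n. q (r n) \<eta> (c *\<^sub>R h)) \<longlonglongrightarrow> c *\<^sub>R D \<eta> h" by simp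
    qed
  qed
  have bd: "norm (D \<eta> h) \<le> norm h * C" for \<eta> h
  proof (rule Lim_norm_ubound[OF sequentially_bot conv])
    have "norm (q (r n) \<eta> h) \<le> norm h * C" for n
    proof -
      have "norm (g (\<eta> + r n *\<^sub>R h) - g \<eta>) \<le> r n * (norm h * C)"
        using lip[of "\<eta> + r n *\<^sub>R h" \<eta>] r[of n] by (simp add: ac_simps)
      moreover have "norm (q (r n) \<eta> h) = norm (g (\<eta> + r n *\<^sub>R h) - g \<eta>) / r n"
        unfolding q_def norm_scaleR using r[of n] by (simp add: divide_inverse mult.commute)
      ultimately show ?thesis using r[of n] by (simp add: pos_divide_le_eq ac_simps)
    qed
    then show "\<forall>\<^sub>F n in sequentially. norm (q (r n) \<eta> h) \<le> norm h * C" by simp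
  qed
  define DD where "DD \<eta> = Blinfun (D \<eta>)" for \<eta>
  have DD: "DD \<eta> h = D \<eta> h" for \<eta> h
    unfolding DD_def by (subst bounded_linear_Blinfun_apply)
      (auto intro!: bounded_linear_intro[where K=C] simp: add scale bd)
  have "(g has_derivative DD \<eta>) (at \<eta>)" for \<eta>
    unfolding has_derivative_at_alt
  proof (intro conjI allI impI)
    fix e :: real assume e: "e > 0"
    obtain d where d: "d > 0" "\<And>h s. s \<noteq> 0 \<Longrightarrow> \<bar>s\<bar> < d \<Longrightarrow> norm h \<le> 1 \<Longrightarrow>
      norm (q s \<eta> h - D \<eta> h) \<le> e"
      using unif[of e \<eta> 1] e by auto
    have "norm (g y - g \<eta> - DD \<eta> (y - \<eta>)) \<le> e * norm (y - \<eta>)" if y: "norm (y - \<eta>) < d" for y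
    proof (cases "y = \<eta>")
      case False
      \<comment> \<open>Polar form of the increment: the distance serves as the step, the unit
        vector as the direction, so directions of norm at most one suffice.\<close>
      define n where "n = norm (y - \<eta>)"
      define h where "h = (y - \<eta>) /\<^sub>R n"
      have n: "n > 0" using False by (simp add: n_def)
      have yh: "y = \<eta> + n *\<^sub>R h" using n by (simp add: h_def)
      have "norm (q n \<eta> h - D \<eta> h) \<le> e" using n y by (intro d) (auto simp: h_def n_def)
      then have "n * norm (q n \<eta> h - D \<eta> h) \<le> n * e" using n by simp
      also have "n * norm (q n \<eta> h - D \<eta> h) = norm (n *\<^sub>R (q n \<eta> h - D \<eta> h))" using n by simp
      also have "n *\<^sub>R (q n \<eta> h - D \<eta> h) = g y - g \<eta> - D \<eta> (n *\<^sub>R h)"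
        unfolding q_def scale using n by (simp add: scaleR_diff_right yh)
      also have "n *\<^sub>R h = y - \<eta>" using yh by simp
      finally show ?thesis by (simp add: DD n_def mult.commute)
    qed (simp)
    with d(1) show "\<exists>d>0. \<forall>y. norm (y - \<eta>) < d \<longrightarrow>
        norm (g y - g \<eta> - DD \<eta> (y - \<eta>)) \<le> e * norm (y - \<eta>)" by blast
  qed (rule blinfun.bounded_linear_right)
  note der = this
  have lim: "((\<lambda>h. DD (\<eta> + h)) \<longlongrightarrow> DD \<eta>) (at 0)" for \<eta>
  proof (rule tendstoI)
    fix e :: real assume e: "e > 0"
    obtain d where d: "d > 0" "\<And>u h s. norm (u - \<eta>) < d \<Longrightarrow> s \<noteq> 0 \<Longrightarrow> \<bar>s\<bar> < d \<Longrightarrow> norm h \<le> 1 \<Longrightarrow>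
      norm (q s u h - D \<eta> h) \<le> e/2"
      using unif[of "e/2" \<eta> 1] e by auto
    have *: "norm (D (\<eta> + k) h - D \<eta> h) \<le> e/2" if k: "norm k < d" and h: "norm h \<le> 1" for k h
    proof (rule Lim_norm_ubound[OF sequentially_bot])
      show "(\<lambda>n. q (r n) (\<eta> + k) h - D \<eta> h) \<longlonglongrightarrow> D (\<eta> + k) h - D \<eta> h"
        by (intro tendsto_intros conv)
      show "\<forall>\<^sub>F n in sequentially. norm (q (r n) (\<eta> + k) h - D \<eta> h) \<le> e/2"
        using r_small[OF d(1)] by eventually_elim (use d(2) k h r in auto)
    qed
    have "norm (DD (\<eta> + k) - DD \<eta>) \<le> e/2" if k: "norm k < d" for k
    proof (rule norm_blinfun_bound)
      fix h
      show "norm ((DD (\<eta> + k) - DD \<eta>) h) \<le> e/2 * norm h"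
      proof (cases "h = 0")
        case False
        have "norm (D (\<eta> + k) (h /\<^sub>R norm h) - D \<eta> (h /\<^sub>R norm h)) \<le> e/2"
          using k False by (intro *) auto
        moreover have "norm (D (\<eta> + k) (h /\<^sub>R norm h) - D \<eta> (h /\<^sub>R norm h)) =
            norm (D (\<eta> + k) h - D \<eta> h) / norm h"
          unfolding scale scaleR_diff_right[symmetric] norm_scaleR
          by (simp add: divide_inverse mult.commute)
        ultimately show ?thesis
          using False by (simp add: blinfun.diff_left DD pos_divide_le_eq)
      qed simp
    qed (use e in simp)
    then have "dist (DD (\<eta> + k)) (DD \<eta>) < e" if "norm k < d" for k
      using e that by (auto simp: dist_norm intro: le_less_trans[of _ "e/2"])
    then show "\<forall>\<^sub>F h in at 0. dist (DD (\<eta> + h)) (DD \<eta>) < e"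
      unfolding eventually_at using d(1) by auto
  qed
  show ?thesis by (intro exI[of _ DD] allI conjI der lim)
qed

section \<open>Exponential splittings\<close>

locale splitting =
  fixes L :: "real \<Rightarrow> real \<Rightarrow> ('a::banach) \<Rightarrow>\<^sub>L 'a" and Q :: "real \<Rightarrow> 'a \<Rightarrow>\<^sub>L 'a" and M \<gamma> \<rho> :: real
  assumes process: "linear_evolution_process L"
    and splitting: "exponential_splitting L Q M \<gamma> \<rho>"
begin

section \<open>Algebra of the process and the projections\<close>

lemma M_ge_1: "1 \<le> M"
  using splitting by (simp add: exponential_splitting_def)

lemma L_comp:
  assumes "\<tau> \<le> s" "s \<le> t"
  shows "L t s (L s \<tau> x) = L t \<tau> x"
proof -
  have "L t \<tau> = L t s o\<^sub>L L s \<tau>"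
    using process assms unfolding linear_evolution_process_def by blast
  from arg_cong[OF this, of "\<lambda>A. A x"] show ?thesis by simp
qed

lemma L_refl [simp]: "L t t x = x"
proof -
  have "L t t = id_blinfun"
    using process unfolding linear_evolution_process_def by blast
  from arg_cong[OF this, of "\<lambda>A. A x"] show ?thesis by simp
qed

lemma continuous_on_L: "continuous_on {(t, \<tau>). \<tau> \<le> t} (\<lambda>(t, \<tau>). L t \<tau> x)"
  using process unfolding linear_evolution_process_def by blast

lemma continuous_on_L_fst: "continuous_on {\<tau>..} (\<lambda>t. L t \<tau> x)"
proof -
  have "continuous_on {\<tau>..} ((\<lambda>(t, \<tau>). L t \<tau> x) \<circ> (\<lambda>t. (t, \<tau>)))"
    by (intro continuous_on_compose continuous_intros continuous_on_subset[OF continuous_on_L]) auto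
  then show ?thesis by (simp add: o_def)
qed

lemma continuous_on_L_snd: "continuous_on {..t} (\<lambda>s. L t s x)"
proof -
  have "continuous_on {..t} ((\<lambda>(t, \<tau>). L t \<tau> x) \<circ> (\<lambda>s. (t, s)))"
    by (intro continuous_on_compose continuous_intros continuous_on_subset[OF continuous_on_L]) auto
  then show ?thesis by (simp add: o_def)
qed

lemma Q_Q [simp]: "Q t (Q t x) = Q t x"
proof -
  have "Q t o\<^sub>L Q t = Q t"
    using splitting unfolding exponential_splitting_def by blast
  from arg_cong[OF this, of "\<lambda>A. A x"] show ?thesis by simp
qed

lemma Q_L:
  assumes "\<tau> \<le> t"
  shows "Q t (L t \<tau> x) = L t \<tau> (Q \<tau> x)"
proof -
  have "Q t o\<^sub>L L t \<tau> = L t \<tau> o\<^sub>L Q \<tau>"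
    using splitting assms unfolding exponential_splitting_def by blast
  from arg_cong[OF this, of "\<lambda>A. A x"] show ?thesis by simp
qed

text \<open>
  \<open>P\<close> is the backward evolution along the range of \<open>Q\<close>, meaningful for \<open>t \<le> s\<close>; \<open>R\<close> is the forward
  evolution along its kernel, meaningful for \<open>s \<le> t\<close>.
\<close>

definition P :: "real \<Rightarrow> real \<Rightarrow> 'a \<Rightarrow>\<^sub>L 'a" where
  "P t s = Blinfun (\<lambda>x. ext_process L Q t s (Q s x))"

definition R :: "real \<Rightarrow> real \<Rightarrow> 'a \<Rightarrow>\<^sub>L 'a" where
  "R t s = L t s o\<^sub>L (id_blinfun - Q s)"

lemma R_apply: "R t s x = L t s (x - Q s x)"
  by (simp add: R_def blinfun.diff_left)

lemma
  assumes "t \<le> s"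
  shows ext_in_range: "ext_process L Q t s (Q s x) \<in> range (Q t)"
    and L_ext: "L s t (ext_process L Q t s (Q s x)) = Q s x"
    and ext_L: "ext_process L Q t s (L s t (Q t x)) = Q t x"
    and continuous_on_ext: "continuous_on (range (Q s)) (ext_process L Q t s)"
proof -
  have *: "homeomorphism (range (Q t)) (range (Q s)) (L s t) (ext_process L Q t s)"
    using splitting assms unfolding exponential_splitting_def by blast
  from homeomorphism_image2[OF *] show "ext_process L Q t s (Q s x) \<in> range (Q t)" by blast
  from homeomorphism_apply2[OF *] show "L s t (ext_process L Q t s (Q s x)) = Q s x" by blast
  from homeomorphism_apply1[OF *] show "ext_process L Q t s (L s t (Q t x)) = Q t x" by blast
  from homeomorphism_cont2[OF *] show "continuous_on (range (Q s)) (ext_process L Q t s)" .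
qed

lemma ext_unique:
  assumes "t \<le> s" and "Q t y = y" and "L s t y = Q s x"
  shows "ext_process L Q t s (Q s x) = y"
  using ext_L[OF assms(1), of y] assms by simp

lemma Q_ext: "t \<le> s \<Longrightarrow> Q t (ext_process L Q t s (Q s x)) = ext_process L Q t s (Q s x)"
  using ext_in_range[of t s x] by auto

text \<open>Uniqueness of preimages gives linearity, the homeomorphism clause gives
  continuity.\<close>

lemma bounded_linear_ext:
  assumes "t \<le> s"
  shows "bounded_linear (\<lambda>x. ext_process L Q t s (Q s x))"
proof (rule bounded_linear_continuous_at_0)
  show "linear (\<lambda>x. ext_process L Q t s (Q s x))"
    by (rule linearI; rule ext_unique[OF assms])
      (simp_all add: blinfun.add_right blinfun.scaleR_right Q_ext L_ext assms)
  have "continuous_on UNIV (\<lambda>x. ext_process L Q t s (Q s x))"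
    by (rule continuous_on_compose2[OF continuous_on_ext[OF assms]]) (auto intro!: continuous_intros)
  then show "isCont (\<lambda>x. ext_process L Q t s (Q s x)) 0"
    by (simp add: continuous_on_eq_continuous_at)
qed

lemma P_apply: "t \<le> s \<Longrightarrow> P t s x = ext_process L Q t s (Q s x)"
  unfolding P_def by (simp add: bounded_linear_Blinfun_apply bounded_linear_ext)

text \<open>Characterizes the backward evolution without unfolding it: \<open>P_refl\<close>,
  \<open>L_P_mid\<close>, \<open>P_P\<close> and \<open>P_L\<close> reduce to checking these two
  conditions.\<close>

lemma P_unique: "t \<le> s \<Longrightarrow> Q t y = y \<Longrightarrow> L s t y = Q s x \<Longrightarrow> P t s x = y"
  by (simp add: P_apply ext_unique)

lemma Q_P: "t \<le> s \<Longrightarrow> Q t (P t s x) = P t s x"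
  by (simp add: P_apply Q_ext)

lemma P_Q: "t \<le> s \<Longrightarrow> P t s (Q s x) = P t s x"
  by (simp add: P_apply)

lemma L_P: "t \<le> s \<Longrightarrow> L s t (P t s x) = Q s x"
  by (simp add: P_apply L_ext)

lemma P_refl: "P t t x = Q t x"
  by (rule P_unique) auto

lemma L_P_mid:
  assumes "r \<le> t" "t \<le> s"
  shows "L t r (P r s x) = P t s x"
proof (rule P_unique[symmetric])
  show "Q t (L t r (P r s x)) = L t r (P r s x)"
    using assms by (simp add: Q_L Q_P)
  show "L s t (L t r (P r s x)) = Q s x"
    using assms by (simp add: L_comp L_P)
qed fact

lemma P_P: "r \<le> t \<Longrightarrow> t \<le> s \<Longrightarrow> P r t (P t s x) = P r s x"
  by (rule P_unique) (simp_all add: Q_P L_P_mid)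

text \<open>With a fixed later time \<open>b\<close>, the dependence on \<open>s\<close> is carried
  by \<open>L b s\<close> alone, which is strongly continuous.\<close>

lemma P_L: "t \<le> s \<Longrightarrow> s \<le> b \<Longrightarrow> P t b (L b s x) = P t s x"
  by (rule P_unique) (simp_all add: Q_P Q_L L_P flip: L_comp[of t s b])

lemma Q_R: "s \<le> t \<Longrightarrow> Q t (R t s x) = 0"
  by (simp add: R_apply Q_L blinfun.diff_right)

lemma P_R: "t \<le> s \<Longrightarrow> u \<le> s \<Longrightarrow> P t s (R s u x) = 0"
  using P_Q[of t s "R s u x"] by (simp add: Q_R)

lemma R_P: "t \<le> u \<Longrightarrow> R s t (P t u x) = 0"
  by (simp add: R_apply Q_P)

lemma R_R: "s \<le> t \<Longrightarrow> t \<le> r \<Longrightarrow> R r t (R t s x) = R r s x"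
  by (simp add: R_apply[of r t] Q_R) (simp add: R_apply L_comp)

text \<open>Moves the projection to the fixed time \<open>t\<close>, since no continuity of
  \<open>Q s\<close> in \<open>s\<close> is assumed.\<close>

lemma R_eq: "s \<le> t \<Longrightarrow> R t s x = L t s x - Q t (L t s x)"
  by (simp add: R_apply Q_L blinfun.diff_right)

section \<open>Exponential bounds and strong continuity\<close>

lemma norm_P: "t \<le> s \<Longrightarrow> norm (P t s) \<le> M * exp (\<rho> * (s - t))"
proof -
  assume ts: "t \<le> s"
  then have "exp (\<rho> * (t - s)) * norm (P t s) \<le> M"
    using splitting unfolding exponential_splitting_def P_def norm_blinfun.rep_eq
    by (simp add: bounded_linear_Blinfun_apply bounded_linear_ext)
  then show ?thesis
    by (simp add: exp_mult_le_iff)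
qed

lemma norm_R: "s \<le> t \<Longrightarrow> norm (R t s) \<le> M * exp (\<gamma> * (s - t))"
proof -
  assume "s \<le> t"
  then have "exp (\<gamma> * (t - s)) * norm (R t s) \<le> M"
    using splitting unfolding exponential_splitting_def R_def by simp
  then show ?thesis
    by (simp add: exp_mult_le_iff)
qed

lemma continuous_on_P_apply:
  assumes "continuous_on {t..b} g"
  shows "continuous_on {t..b} (\<lambda>s. P t s (g s))"
proof (rule continuous_on_blinfun_family[where b="\<lambda>s. M * exp (\<rho> * (s - t))"])
  fix x
  have "continuous_on {t..b} (\<lambda>s. P t b (L b s x))"
    by (intro continuous_intros continuous_on_subset[OF continuous_on_L_snd]) auto
  then show "continuous_on {t..b} (\<lambda>s. P t s x)"
    by (rule continuous_on_eq) (simp add: P_L)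
qed (auto intro!: continuous_intros norm_P assms)

lemma continuous_on_R_apply:
  assumes "continuous_on {..t} g"
  shows "continuous_on {..t} (\<lambda>s. R t s (g s))"
proof (rule continuous_on_blinfun_family[where b="\<lambda>s. M * exp (\<gamma> * (s - t))"])
  fix x
  have "continuous_on {..t} (\<lambda>s. L t s x - Q t (L t s x))"
    by (intro continuous_intros continuous_on_L_snd)
  then show "continuous_on {..t} (\<lambda>s. R t s x)"
    by (rule continuous_on_eq) (simp add: R_eq)
qed (auto intro!: continuous_intros norm_R assms)

section \<open>Adapted norms of the two components\<close>

definition nN :: "real \<Rightarrow> 'a \<Rightarrow> real" where "nN \<tau> x = norm_N L Q \<rho> \<tau> (Q \<tau> x)"

text \<open>Like \<open>nN\<close>, composed with the projection, so that it is a seminorm on the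
  whole space.\<close>

definition nS :: "real \<Rightarrow> 'a \<Rightarrow> real" where "nS \<tau> x = norm_S L \<gamma> \<tau> ((id_blinfun - Q \<tau>) x)"

lemma nN_eq: "nN \<tau> x = (SUP t\<in>{..\<tau>}. exp (\<rho> * (t - \<tau>)) * norm (P t \<tau> x))"
  unfolding nN_def norm_N_def by (intro SUP_cong) (auto simp: P_apply)

lemma nS_eq: "nS \<tau> x = (SUP t\<in>{\<tau>..}. exp (\<gamma> * (t - \<tau>)) * norm (R t \<tau> x))"
  unfolding nS_def norm_S_def by (simp add: R_apply blinfun.diff_left)

lemma nN_leI:
  assumes "\<And>t. t \<le> \<tau> \<Longrightarrow> norm (P t \<tau> x) \<le> c * exp (\<rho> * (\<tau> - t))"
  shows "nN \<tau> x \<le> c"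
  unfolding nN_eq
proof (rule cSUP_least)
  fix t assume "t \<in> {..\<tau>}"
  then have "norm (P t \<tau> x) \<le> c * exp (\<rho> * (\<tau> - t))" using assms by simp
  then show "exp (\<rho> * (t - \<tau>)) * norm (P t \<tau> x) \<le> c"
    by (simp add: exp_mult_le_iff)
qed simp

lemma nS_leI:
  assumes "\<And>t. \<tau> \<le> t \<Longrightarrow> norm (R t \<tau> x) \<le> c * exp (\<gamma> * (\<tau> - t))"
  shows "nS \<tau> x \<le> c"
  unfolding nS_eq
proof (rule cSUP_least)
  fix t assume "t \<in> {\<tau>..}"
  then have "norm (R t \<tau> x) \<le> c * exp (\<gamma> * (\<tau> - t))" using assms by simp
  then show "exp (\<gamma> * (t - \<tau>)) * norm (R t \<tau> x) \<le> c"
    by (simp add: exp_mult_le_iff)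
qed simp

lemma norm_P_apply: "t \<le> \<tau> \<Longrightarrow> norm (P t \<tau> x) \<le> M * norm x * exp (\<rho> * (\<tau> - t))"
  using norm_blinfun[of "P t \<tau>" x] mult_right_mono[OF norm_P[of t \<tau>], of "norm x"]
  by (simp add: ac_simps)

lemma norm_R_apply: "\<tau> \<le> t \<Longrightarrow> norm (R t \<tau> x) \<le> M * norm x * exp (\<gamma> * (\<tau> - t))"
  using norm_blinfun[of "R t \<tau>" x] mult_right_mono[OF norm_R[of \<tau> t], of "norm x"]
  by (simp add: ac_simps)

lemma nN_D:
  assumes "t \<le> \<tau>"
  shows "norm (P t \<tau> x) \<le> nN \<tau> x * exp (\<rho> * (\<tau> - t))"
proof -
  have "bdd_above ((\<lambda>t. exp (\<rho> * (t - \<tau>)) * norm (P t \<tau> x)) ` {..\<tau>})"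
    by (rule bdd_aboveI2[where M="M * norm x"]) (simp add: exp_mult_le_iff norm_P_apply)
  from cSUP_upper[OF _ this, of t] show ?thesis
    using assms by (simp add: exp_mult_le_iff nN_eq)
qed

lemma nS_D:
  assumes "\<tau> \<le> t"
  shows "norm (R t \<tau> x) \<le> nS \<tau> x * exp (\<gamma> * (\<tau> - t))"
proof -
  have "bdd_above ((\<lambda>t. exp (\<gamma> * (t - \<tau>)) * norm (R t \<tau> x)) ` {\<tau>..})"
    by (rule bdd_aboveI2[where M="M * norm x"]) (simp add: exp_mult_le_iff norm_R_apply)
  from cSUP_upper[OF _ this, of t] show ?thesis
    using assms by (simp add: exp_mult_le_iff nS_eq)
qed

lemma nN_le: "nN \<tau> x \<le> M * norm x"
  by (rule nN_leI) (rule norm_P_apply)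

lemma nS_le: "nS \<tau> x \<le> M * norm x"
  by (rule nS_leI) (rule norm_R_apply)

lemma norm_le_nN_nS: "norm x \<le> nN \<tau> x + nS \<tau> x"
proof -
  have "x = P \<tau> \<tau> x + R \<tau> \<tau> x" by (simp add: P_refl R_apply)
  then have "norm x \<le> norm (P \<tau> \<tau> x) + norm (R \<tau> \<tau> x)" by (metis norm_triangle_ineq)
  then show ?thesis using nN_D[of \<tau> \<tau> x] nS_D[of \<tau> \<tau> x] by simp
qed

lemma nN_nonneg: "0 \<le> nN \<tau> x"
  using nN_D[of \<tau> \<tau> x] order_trans[OF norm_ge_zero] by simp

lemma nS_nonneg: "0 \<le> nS \<tau> x"
  using nS_D[of \<tau> \<tau> x] order_trans[OF norm_ge_zero] by simp

lemma nN_add: "nN \<tau> (x + y) \<le> nN \<tau> x + nN \<tau> y"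
proof (rule nN_leI)
  fix t assume "t \<le> \<tau>"
  then show "norm (P t \<tau> (x + y)) \<le> (nN \<tau> x + nN \<tau> y) * exp (\<rho> * (\<tau> - t))"
    unfolding blinfun.add_right distrib_right by (intro norm_triangle_mono nN_D)
qed

lemma nS_add: "nS \<tau> (x + y) \<le> nS \<tau> x + nS \<tau> y"
proof (rule nS_leI)
  fix t assume "\<tau> \<le> t"
  then show "norm (R t \<tau> (x + y)) \<le> (nS \<tau> x + nS \<tau> y) * exp (\<gamma> * (\<tau> - t))"
    unfolding blinfun.add_right distrib_right by (intro norm_triangle_mono nS_D)
qed

lemma nN_scaleR: "nN \<tau> (c *\<^sub>R x) \<le> \<bar>c\<bar> * nN \<tau> x"
proof (rule nN_leI)
  fix t assume "t \<le> \<tau>"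
  then show "norm (P t \<tau> (c *\<^sub>R x)) \<le> \<bar>c\<bar> * nN \<tau> x * exp (\<rho> * (\<tau> - t))"
    unfolding blinfun.scaleR_right norm_scaleR mult.assoc by (intro mult_left_mono nN_D) auto
qed

lemma nS_scaleR: "nS \<tau> (c *\<^sub>R x) \<le> \<bar>c\<bar> * nS \<tau> x"
proof (rule nS_leI)
  fix t assume "\<tau> \<le> t"
  then show "norm (R t \<tau> (c *\<^sub>R x)) \<le> \<bar>c\<bar> * nS \<tau> x * exp (\<gamma> * (\<tau> - t))"
    unfolding blinfun.scaleR_right norm_scaleR mult.assoc by (intro mult_left_mono nS_D) auto
qed

text \<open>No factor \<open>M\<close> appears: the supremum in the adapted norm already runs over
  all earlier times. Estimates of this kind keep \<open>M\<close> out of the gap condition.\<close>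

lemma nN_P: "t \<le> \<tau> \<Longrightarrow> nN t (P t \<tau> x) \<le> nN \<tau> x * exp (\<rho> * (\<tau> - t))"
proof (rule nN_leI)
  fix r assume "t \<le> \<tau>" "r \<le> t"
  then show "norm (P r t (P t \<tau> x)) \<le> nN \<tau> x * exp (\<rho> * (\<tau> - t)) * exp (\<rho> * (t - r))"
    using nN_D[of r \<tau> x] exp_add[of "\<rho> * (\<tau> - t)" "\<rho> * (t - r)"]
    by (simp add: P_P mult.assoc) (simp add: algebra_simps)
qed

lemma nS_P: "t \<le> \<tau> \<Longrightarrow> nS t (P t \<tau> x) \<le> 0"
  by (rule nS_leI) (simp add: R_P)

section \<open>Component norms of the two integrals\<close>

lemma P_integral:
  assumes "r \<le> t" and g: "continuous_on {t..\<tau>} g"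
  shows "P r t (integral {t..\<tau>} (\<lambda>s. P t s (g s))) = integral {t..\<tau>} (\<lambda>s. P r s (g s))"
proof -
  have "integral {t..\<tau>} (blinfun_apply (P r t) \<circ> (\<lambda>s. P t s (g s))) =
      P r t (integral {t..\<tau>} (\<lambda>s. P t s (g s)))"
    by (intro integral_linear integrable_continuous_interval continuous_on_P_apply g
        blinfun.bounded_linear_right)
  moreover have "integral {t..\<tau>} (blinfun_apply (P r t) \<circ> (\<lambda>s. P t s (g s))) =
      integral {t..\<tau>} (\<lambda>s. P r s (g s))"
    using assms by (intro integral_cong) (simp add: P_P)
  ultimately show ?thesis by simp
qed

text \<open>The component norm is a supremum over the norms of \<open>P r t x\<close>, and each
  bounded operator \<open>P r t\<close> can be moved under the integral. The majorant
  \<open>h\<close> is supplied from outside because \<open>nN s (g s)\<close> is not known to be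
  integrable in \<open>s\<close>.\<close>

lemma nN_integral:
  assumes "t \<le> \<tau>" and g: "continuous_on {t..\<tau>} g" and h: "h integrable_on {t..\<tau>}"
    and le: "\<And>s. t \<le> s \<Longrightarrow> s \<le> \<tau> \<Longrightarrow> exp (\<rho> * (s - t)) * nN s (g s) \<le> h s"
    and c: "integral {t..\<tau>} h \<le> c"
  shows "nN t (integral {t..\<tau>} (\<lambda>s. P t s (g s))) \<le> c"
proof (rule nN_leI)
  fix r assume r: "r \<le> t"
  have "norm (integral {t..\<tau>} (\<lambda>s. P r s (g s))) \<le>
      integral {t..\<tau>} (\<lambda>s. exp (\<rho> * (t - r)) * h s)"
  proof (rule integral_norm_bound_integral)
    have "continuous_on {t..\<tau>} (\<lambda>s. P r t (P t s (g s)))"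
      by (intro continuous_intros continuous_on_P_apply g)
    then have "continuous_on {t..\<tau>} (\<lambda>s. P r s (g s))"
      by (rule continuous_on_eq) (use r in \<open>simp add: P_P\<close>)
    then show "(\<lambda>s. P r s (g s)) integrable_on {t..\<tau>}"
      by (rule integrable_continuous_interval)
    show "(\<lambda>s. exp (\<rho> * (t - r)) * h s) integrable_on {t..\<tau>}"
      by (intro integrable_on_mult_right h)
    fix s assume s: "s \<in> {t..\<tau>}"
    have "norm (P r s (g s)) \<le> nN s (g s) * exp (\<rho> * (s - r))"
      using r s by (intro nN_D) auto
    also have "exp (\<rho> * (s - r)) = exp (\<rho> * (t - r)) * exp (\<rho> * (s - t))"
      unfolding exp_add[symmetric] by (simp add: algebra_simps)
    also have "nN s (g s) * \<dots> = exp (\<rho> * (t - r)) * (exp (\<rho> * (s - t)) * nN s (g s))"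
      by simp
    also have "\<dots> \<le> exp (\<rho> * (t - r)) * h s"
      using le s by simp
    finally show "norm (P r s (g s)) \<le> exp (\<rho> * (t - r)) * h s" .
  qed
  also have "\<dots> \<le> c * exp (\<rho> * (t - r))"
    using mult_right_mono[OF c, of "exp (\<rho> * (t - r))"] by (simp add: mult.commute)
  finally show "norm (P r t (integral {t..\<tau>} (\<lambda>s. P t s (g s)))) \<le> c * exp (\<rho> * (t - r))"
    using r by (simp add: P_integral g)
qed

lemma nS_integral_P:
  assumes g: "continuous_on {t..\<tau>} g"
  shows "nS t (integral {t..\<tau>} (\<lambda>s. P t s (g s))) \<le> 0"
proof (rule nS_leI)
  fix r assume r: "t \<le> r"
  have "integral {t..\<tau>} (blinfun_apply (R r t) \<circ> (\<lambda>s. P t s (g s))) =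
      R r t (integral {t..\<tau>} (\<lambda>s. P t s (g s)))"
    by (intro integral_linear integrable_continuous_interval continuous_on_P_apply g
        blinfun.bounded_linear_right)
  moreover have "integral {t..\<tau>} (blinfun_apply (R r t) \<circ> (\<lambda>s. P t s (g s))) =
      integral {t..\<tau>} (\<lambda>s. 0)"
    by (intro integral_cong) (simp add: R_P)
  ultimately show "norm (R r t (integral {t..\<tau>} (\<lambda>s. P t s (g s)))) \<le> 0 * exp (\<gamma> * (t - r))"
    by simp
qed

lemma integrable_R:
  assumes g: "continuous_on {..t} g" and h: "h integrable_on {..t}"
    and le: "\<And>s. s \<le> t \<Longrightarrow> exp (\<gamma> * (s - t)) * nS s (g s) \<le> h s"
  shows "(\<lambda>s. R t s (g s)) integrable_on {..t}"
proof (rule integrable_Iic_continuous_bound[OF continuous_on_R_apply[OF g] _ h])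
  fix s assume "s \<le> t"
  then show "norm (R t s (g s)) \<le> h s"
    using nS_D[of s t "g s"] le[of s] by (simp add: mult.commute)
qed

lemma R_integral:
  assumes "t \<le> r" and i: "(\<lambda>s. R t s (g s)) integrable_on {..t}"
  shows "(\<lambda>s. R r s (g s)) integrable_on {..t}"
    and "R r t (integral {..t} (\<lambda>s. R t s (g s))) = integral {..t} (\<lambda>s. R r s (g s))"
proof -
  have "((blinfun_apply (R r t) \<circ> (\<lambda>s. R t s (g s))) has_integral
      R r t (integral {..t} (\<lambda>s. R t s (g s)))) {..t}"
    by (intro has_integral_linear integrable_integral i blinfun.bounded_linear_right)
  then have *: "((\<lambda>s. R r s (g s)) has_integral
      R r t (integral {..t} (\<lambda>s. R t s (g s)))) {..t}"
    by (rule has_integral_eq[rotated]) (use assms in \<open>simp add: R_R\<close>)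
  then show "(\<lambda>s. R r s (g s)) integrable_on {..t}"
    by blast
  show "R r t (integral {..t} (\<lambda>s. R t s (g s))) = integral {..t} (\<lambda>s. R r s (g s))"
    using * by (simp add: integral_unique)
qed

text \<open>Kernel counterpart of \<open>nN_integral\<close>. The integral is improper, so
  integrability has to be secured before \<open>R r t\<close> is moved inside.\<close>

lemma nS_integral:
  assumes g: "continuous_on {..t} g" and h: "h integrable_on {..t}"
    and le: "\<And>s. s \<le> t \<Longrightarrow> exp (\<gamma> * (s - t)) * nS s (g s) \<le> h s"
    and c: "integral {..t} h \<le> c"
  shows "nS t (integral {..t} (\<lambda>s. R t s (g s))) \<le> c"
proof (rule nS_leI)
  fix r assume r: "t \<le> r"
  note i = integrable_R[OF g h le]
  have "norm (integral {..t} (\<lambda>s. R r s (g s))) \<le>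
      integral {..t} (\<lambda>s. exp (\<gamma> * (t - r)) * h s)"
  proof (rule integral_norm_bound_integral)
    show "(\<lambda>s. R r s (g s)) integrable_on {..t}" by (rule R_integral(1)[OF r i])
    show "(\<lambda>s. exp (\<gamma> * (t - r)) * h s) integrable_on {..t}"
      by (intro integrable_on_mult_right h)
    fix s assume s: "s \<in> {..t}"
    have "norm (R r s (g s)) \<le> nS s (g s) * exp (\<gamma> * (s - r))"
      using r s by (intro nS_D) auto
    also have "exp (\<gamma> * (s - r)) = exp (\<gamma> * (t - r)) * exp (\<gamma> * (s - t))"
      unfolding exp_add[symmetric] by (simp add: algebra_simps)
    also have "nS s (g s) * \<dots> = exp (\<gamma> * (t - r)) * (exp (\<gamma> * (s - t)) * nS s (g s))"
      by simp
    also have "\<dots> \<le> exp (\<gamma> * (t - r)) * h s"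
      using le s by simp
    finally show "norm (R r s (g s)) \<le> exp (\<gamma> * (t - r)) * h s" .
  qed
  also have "\<dots> \<le> c * exp (\<gamma> * (t - r))"
    using mult_right_mono[OF c, of "exp (\<gamma> * (t - r))"] by (simp add: mult.commute)
  finally show "norm (R r t (integral {..t} (\<lambda>s. R t s (g s)))) \<le> c * exp (\<gamma> * (t - r))"
    by (simp add: R_integral(2)[OF r i])
qed

lemma nN_integral_R:
  assumes i: "(\<lambda>s. R t s (g s)) integrable_on {..t}"
  shows "nN t (integral {..t} (\<lambda>s. R t s (g s))) \<le> 0"
proof (rule nN_leI)
  fix r assume r: "r \<le> t"
  have "integral {..t} (blinfun_apply (P r t) \<circ> (\<lambda>s. R t s (g s))) =
      P r t (integral {..t} (\<lambda>s. R t s (g s)))"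
    by (intro integral_linear i blinfun.bounded_linear_right)
  moreover have "integral {..t} (blinfun_apply (P r t) \<circ> (\<lambda>s. R t s (g s))) =
      integral {..t} (\<lambda>s. 0)"
    using r by (intro integral_cong) (simp add: P_R)
  ultimately show "norm (P r t (integral {..t} (\<lambda>s. R t s (g s)))) \<le> 0 * exp (\<rho> * (t - r))"
    by simp
qed

section \<open>Continuity of the integrals in time\<close>

lemma continuous_on_P_fst: "continuous_on {..\<tau>} (\<lambda>t. P t \<tau> x)"
proof (rule continuous_on_Iic)
  fix a assume "a < \<tau>"
  \<comment> \<open>On a compact interval the backward orbit is a forward orbit of \<open>L\<close>
    started at the left end.\<close>
  have "continuous_on {a..\<tau>} (\<lambda>t. L t a (P a \<tau> x))"
    by (rule continuous_on_subset[OF continuous_on_L_fst]) auto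
  then show "continuous_on {a..\<tau>} (\<lambda>t. P t \<tau> x)"
    by (rule continuous_on_eq) (simp add: L_P_mid)
qed

text \<open>
  On \<open>{a..\<tau>}\<close> the integrand factors through \<open>P a s\<close>; its coefficient, the restriction of \<open>L t a\<close> to
  the range of \<open>Q a\<close>, is locally bounded in \<open>t\<close> because it is \<open>P t \<tau> o\<^sub>L L \<tau> a\<close>.
\<close>

lemma continuous_on_integral_P:
  assumes g: "continuous_on {..\<tau>} g"
  shows "continuous_on {..\<tau>} (\<lambda>t. integral {t..\<tau>} (\<lambda>s. P t s (g s)))"
proof (rule continuous_on_Iic)
  fix a assume a: "a < \<tau>"
  have ga: "continuous_on {a..\<tau>} g" by (rule continuous_on_subset[OF g]) auto
  note P_int = integrable_continuous_interval[OF continuous_on_P_apply[OF ga]]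
  have "continuous_on {a..\<tau>} (\<lambda>t. (P t \<tau> o\<^sub>L L \<tau> a) (integral {t..\<tau>} (\<lambda>s. P a s (g s))))"
  proof (rule continuous_on_blinfun_family[where b="\<lambda>t. M * exp (\<rho> * (\<tau> - t)) * norm (L \<tau> a)"])
    fix t assume "t \<in> {a..\<tau>}"
    then show "norm (P t \<tau> o\<^sub>L L \<tau> a) \<le> M * exp (\<rho> * (\<tau> - t)) * norm (L \<tau> a)"
      by (intro order_trans[OF norm_blinfun_compose] mult_right_mono norm_P) auto
  next
    show "continuous_on {a..\<tau>} (\<lambda>t. (P t \<tau> o\<^sub>L L \<tau> a) x)" for x
      using continuous_on_subset[OF continuous_on_P_fst, of "{a..\<tau>}" \<tau> "L \<tau> a x"] by auto
    show "continuous_on {a..\<tau>} (\<lambda>t. integral {t..\<tau>} (\<lambda>s. P a s (g s)))"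
      by (rule indefinite_integral_continuous_1') (rule P_int)
  qed (intro continuous_intros)
  then show "continuous_on {a..\<tau>} (\<lambda>t. integral {t..\<tau>} (\<lambda>s. P t s (g s)))"
  proof (rule continuous_on_eq)
    fix t assume t: "t \<in> {a..\<tau>}"
    have gt: "continuous_on {t..\<tau>} g" by (rule continuous_on_subset[OF g]) auto
    have "P a t (integral {t..\<tau>} (\<lambda>s. P t s (g s))) = integral {t..\<tau>} (\<lambda>s. P a s (g s))"
      using t by (intro P_integral gt) auto
    then have "(P t \<tau> o\<^sub>L L \<tau> a) (integral {t..\<tau>} (\<lambda>s. P a s (g s))) =
        P t \<tau> (L \<tau> a (P a t (integral {t..\<tau>} (\<lambda>s. P t s (g s)))))"
      by simp
    also have "\<dots> = P t \<tau> (L \<tau> t (L t a (P a t (integral {t..\<tau>} (\<lambda>s. P t s (g s))))))"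
      using t by (simp add: L_comp)
    also have "\<dots> = P t t (integral {t..\<tau>} (\<lambda>s. P t s (g s)))"
      using t by (simp add: P_L L_P P_refl)
    also have "\<dots> = integral {t..\<tau>} (\<lambda>s. P t s (g s))"
      by (rule P_integral[OF order_refl gt])
    finally show "(P t \<tau> o\<^sub>L L \<tau> a) (integral {t..\<tau>} (\<lambda>s. P a s (g s))) =
        integral {t..\<tau>} (\<lambda>s. P t s (g s))" .
  qed
qed

lemma integral_R_split:
  assumes ta: "a \<le> t" and g: "continuous_on {..t} g"
    and i: "(\<lambda>s. R a s (g s)) integrable_on {..a}"
  shows "integral {..t} (\<lambda>s. R t s (g s)) =
      R t a (integral {..a} (\<lambda>s. R a s (g s))) + integral {a..t} (\<lambda>s. R t s (g s))"
proof -
  have "continuous_on {a..t} (\<lambda>s. R t s (g s))"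
    by (rule continuous_on_subset[OF continuous_on_R_apply[OF g]]) auto
  then have "(\<lambda>s. R t s (g s)) integrable_on {a..t}" by (rule integrable_continuous_interval)
  moreover have "{..t} = {..a} \<union> {a..t}" using ta by auto
  moreover have "negligible ({..a} \<inter> {a..t})"
    by (rule negligible_subset[of "{a}"]) auto
  ultimately show ?thesis
    by (simp add: R_integral[OF ta i])
qed

text \<open>The history up to \<open>t - d\<close> is a fixed vector carried forward by
  \<open>R u (t - d)\<close>, hence continuous in \<open>u\<close>. The remaining piece is short
  with a bounded integrand, and contributes at most \<open>e\<close>.\<close>

lemma continuous_on_integral_R:
  assumes g: "continuous_on {..\<tau>} g"
    and i: "\<And>t. t \<le> \<tau> \<Longrightarrow> (\<lambda>s. R t s (g s)) integrable_on {..t}"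
  shows "continuous_on {..\<tau>} (\<lambda>t. integral {..t} (\<lambda>s. R t s (g s)))"
proof (rule continuous_on_local_approx)
  fix t e :: real assume t: "t \<in> {..\<tau>}" and e: "e > 0"
  have "compact (g ` {t - 1..\<tau>})"
    by (intro compact_continuous_image continuous_on_subset[OF g]) auto
  from compact_imp_bounded[OF this, unfolded bounded_pos]
  obtain G where G: "G > 0" "\<And>s. t - 1 \<le> s \<Longrightarrow> s \<le> \<tau> \<Longrightarrow> norm (g s) \<le> G"
    by auto
  \<comment> \<open>Bounds the integrand on the window \<open>{t - 1..\<tau>}\<close>; the absolute
    value covers both signs of \<open>\<gamma>\<close>.\<close>
  define B where "B = M * G * exp (\<bar>\<gamma>\<bar> * (\<tau> - t + 1))"
  have B: "B > 0" using M_ge_1 G by (simp add: B_def)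
  have RB: "norm (R u s (g s)) \<le> B" if "t - 1 \<le> s" "s \<le> u" "u \<le> \<tau>" for s u
  proof -
    have "\<gamma> * (s - u) \<le> \<bar>\<gamma>\<bar> * \<bar>s - u\<bar>" by (metis abs_ge_self abs_mult)
    also have "\<dots> \<le> \<bar>\<gamma>\<bar> * (\<tau> - t + 1)" using that by (intro mult_left_mono) auto
    finally have "exp (\<gamma> * (s - u)) \<le> exp (\<bar>\<gamma>\<bar> * (\<tau> - t + 1))" by simp
    moreover have "M * norm (g s) \<le> M * G" using that G(2)[of s] M_ge_1 by simp
    moreover have "norm (R u s (g s)) \<le> M * norm (g s) * exp (\<gamma> * (s - u))"
      using that by (intro norm_R_apply)
    ultimately show ?thesis
      unfolding B_def using M_ge_1 G(1)
      by (smt (verit) mult_mono exp_ge_zero mult_nonneg_nonneg norm_ge_zero)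
  qed
  \<comment> \<open>The piece from \<open>t - d\<close> to \<open>u\<close> is shorter than
    \<open>2 * d\<close>, whence \<open>2 * d * B \<le> e\<close>; the cap 1 keeps it inside the
    window of \<open>B\<close>.\<close>
  define d where "d = min 1 (e / (2 * B))"
  have d: "0 < d" "d \<le> 1" "2 * d * B \<le> e"
    using e B by (auto simp: d_def field_simps min_def)
  let ?h = "\<lambda>u. R u (t - d) (integral {..t - d} (\<lambda>s. R (t - d) s (g s)))"
  show "\<exists>h d. d > 0 \<and> continuous_on ({..\<tau>} \<inter> ball t d) h \<and>
      (\<forall>u\<in>{..\<tau>}. dist u t < d \<longrightarrow> dist (integral {..u} (\<lambda>s. R u s (g s))) (h u) \<le> e)"
  proof (intro exI[of _ ?h] exI[of _ d] conjI ballI impI)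
    have "continuous_on ({..\<tau>} \<inter> ball t d) (\<lambda>u. L u (t - d) x)" for x
      by (rule continuous_on_subset[OF continuous_on_L_fst]) (auto simp: dist_real_def)
    then show "continuous_on ({..\<tau>} \<inter> ball t d) ?h" by (simp add: R_apply)
    fix u assume u: "u \<in> {..\<tau>}" "dist u t < d"
    have gu: "continuous_on {..u} g" by (rule continuous_on_subset[OF g]) (use u in auto)
    have "norm (integral {t - d..u} (\<lambda>s. R u s (g s))) \<le> B * (u - (t - d))"
    proof (rule integral_bound)
      show "continuous_on {t - d..u} (\<lambda>s. R u s (g s))"
        by (rule continuous_on_subset[OF continuous_on_R_apply[OF gu]]) auto
    qed (use u d RB in \<open>auto simp: dist_real_def\<close>)
    also have "\<dots> \<le> B * (2 * d)"
      using B u by (intro mult_left_mono) (auto simp: dist_real_def)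
    also have "\<dots> \<le> e" using d by (simp add: mult.commute)
    finally show "dist (integral {..u} (\<lambda>s. R u s (g s))) (?h u) \<le> e"
      using u t d by (subst integral_R_split[of "t - d"]) (auto simp: dist_real_def dist_norm gu i)
  qed fact
qed

end

section \<open>The weighted norm and the integral operator\<close>

locale weighted_splitting = splitting +
  fixes \<Gamma> :: "real \<times> real \<Rightarrow> real"
  assumes admissible: "admissible_norm \<Gamma>"
begin

section \<open>The mixed norm and its equivalence with the original one\<close>

lemma \<Gamma>_nonneg: "0 \<le> \<Gamma> v"
  using admissible unfolding admissible_norm_def by blast

lemma \<Gamma>_pos: "v \<noteq> 0 \<Longrightarrow> 0 < \<Gamma> v"
  using admissible \<Gamma>_nonneg[of v] unfolding admissible_norm_def by (metis order_less_le)

lemma \<Gamma>_mult: "0 \<le> c \<Longrightarrow> \<Gamma> (c * a, c * b) = c * \<Gamma> (a, b)"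
proof -
  assume c: "0 \<le> c"
  have "\<Gamma> (c *\<^sub>R (a, b)) = \<bar>c\<bar> * \<Gamma> (a, b)"
    using admissible unfolding admissible_norm_def by blast
  then show ?thesis using c by simp
qed

lemma \<Gamma>_add: "\<Gamma> (a + a', b + b') \<le> \<Gamma> (a, b) + \<Gamma> (a', b')"
proof -
  have "\<Gamma> ((a, b) + (a', b')) \<le> \<Gamma> (a, b) + \<Gamma> (a', b')"
    using admissible unfolding admissible_norm_def by blast
  then show ?thesis by simp
qed

lemma \<Gamma>_mono:
  assumes "0 \<le> a" "a \<le> a'" "0 \<le> b" "b \<le> b'"
  shows "\<Gamma> (a, b) \<le> \<Gamma> (a', b')"
proof -
  have "mono_on {0..} (\<lambda>b. \<Gamma> (a, b))" "mono_on {0..} (\<lambda>a. \<Gamma> (a, b'))"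
    using admissible assms unfolding admissible_norm_def by (meson order_trans)+
  from mono_onD[OF this(1), of b b'] mono_onD[OF this(2), of a a'] show ?thesis
    using assms by simp
qed

definition nA :: "real \<Rightarrow> 'a \<Rightarrow> real" where "nA t x = \<Gamma> (nN t x, nS t x)"

lemma norm_at_eq: "norm_at L Q \<gamma> \<rho> \<Gamma> t x = nA t x"
  by (simp add: norm_at_def nA_def nN_def nS_def)

lemma nA_nonneg: "0 \<le> nA t x"
  by (simp add: nA_def \<Gamma>_nonneg)

lemma nA_leI: "nN t x \<le> a \<Longrightarrow> nS t x \<le> b \<Longrightarrow> nA t x \<le> \<Gamma> (a, b)"
  unfolding nA_def by (intro \<Gamma>_mono nN_nonneg nS_nonneg)

lemma nA_add: "nA t (x + y) \<le> nA t x + nA t y"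
  unfolding nA_def by (intro order_trans[OF \<Gamma>_mono \<Gamma>_add] nN_add nS_add nN_nonneg nS_nonneg)

lemma nA_scaleR: "nA t (c *\<^sub>R x) \<le> \<bar>c\<bar> * nA t x"
  unfolding nA_def
  by (subst \<Gamma>_mult[symmetric]) (auto intro!: \<Gamma>_mono nN_scaleR nS_scaleR nN_nonneg nS_nonneg)

lemma nA_minus: "nA t (- x) \<le> nA t x"
  using nA_scaleR[of t "-1" x] by simp

text \<open>\<open>C\<^sub>1\<close> and \<open>C\<^sub>2\<close> are the constants of equivalence
  between \<open>nA t\<close> and the norm of the space, the same for all \<open>t\<close>. The
  first arises since both components are at most \<open>M * norm x\<close>, the second from
  monotonicity of \<open>\<Gamma>\<close>, by dropping one component at a time.\<close>

definition C\<^sub>1 :: real where "C\<^sub>1 = M * \<Gamma> (1, 1)"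

definition C\<^sub>2 :: real where "C\<^sub>2 = 1 / \<Gamma> (1, 0) + 1 / \<Gamma> (0, 1)"

lemma C1_nonneg: "0 \<le> C\<^sub>1"
  using M_ge_1 \<Gamma>_nonneg by (simp add: C\<^sub>1_def)

lemma C2_nonneg: "0 \<le> C\<^sub>2"
  using \<Gamma>_nonneg by (simp add: C\<^sub>2_def)

lemma nA_le: "nA t x \<le> C\<^sub>1 * norm x"
proof -
  have "nA t x \<le> \<Gamma> (M * norm x * 1, M * norm x * 1)"
    using nN_le nS_le by (intro nA_leI) auto
  also have "\<dots> = C\<^sub>1 * norm x"
    using M_ge_1 by (subst \<Gamma>_mult) (auto simp: C\<^sub>1_def)
  finally show ?thesis .
qed

lemma norm_le_nA: "norm x \<le> C\<^sub>2 * nA t x"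
proof -
  have *: "\<Gamma> (1, 0) > 0" "\<Gamma> (0, 1) > 0" by (auto intro: \<Gamma>_pos simp: zero_prod_def)
  have "nN t x * \<Gamma> (1, 0) \<le> nA t x"
    unfolding nA_def using \<Gamma>_mult[OF nN_nonneg, of t x 1 0]
      \<Gamma>_mono[of "nN t x" "nN t x" 0 "nS t x"] nN_nonneg nS_nonneg by simp
  moreover have "nS t x * \<Gamma> (0, 1) \<le> nA t x"
    unfolding nA_def using \<Gamma>_mult[OF nS_nonneg, of t x 0 1]
      \<Gamma>_mono[of 0 "nN t x" "nS t x" "nS t x"] nN_nonneg nS_nonneg by simp
  ultimately have "nN t x + nS t x \<le> nA t x / \<Gamma> (1, 0) + nA t x / \<Gamma> (0, 1)"
    using * by (intro add_mono) (simp_all add: pos_le_divide_eq)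
  then show ?thesis
    using norm_le_nN_nS[of x t] by (simp add: C\<^sub>2_def distrib_right)
qed

lemma nA_P:
  assumes "t \<le> \<tau>" "\<rho> \<le> \<sigma>"
  shows "nA t (P t \<tau> x) \<le> C\<^sub>1 * norm x * exp (\<sigma> * (\<tau> - t))"
proof -
  let ?c = "M * norm x * exp (\<sigma> * (\<tau> - t))"
  have c: "0 \<le> ?c" using M_ge_1 by simp
  have "exp (\<rho> * (\<tau> - t)) \<le> exp (\<sigma> * (\<tau> - t))"
    using assms by (simp add: mult_right_mono)
  then have "nN \<tau> x * exp (\<rho> * (\<tau> - t)) \<le> ?c"
    using M_ge_1 by (intro mult_mono nN_le) auto
  then have "nN t (P t \<tau> x) \<le> ?c" using nN_P[OF assms(1), of x] by simp
  moreover have "nS t (P t \<tau> x) \<le> ?c" using nS_P[OF assms(1), of x] c by simp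
  ultimately have "nA t (P t \<tau> x) \<le> \<Gamma> (?c * 1, ?c * 1)" by (intro nA_leI) auto
  also have "\<dots> = ?c * \<Gamma> (1, 1)" using c by (rule \<Gamma>_mult)
  finally show ?thesis by (simp add: C\<^sub>1_def mult.commute mult.left_commute)
qed

text \<open>Kernel components accumulate from the past, range components are solved backwards from
  \<open>\<tau>\<close>. At \<open>t = \<tau>\<close> only the first integral remains, so
  \<open>K\<close> adds nothing to the range component prescribed there.\<close>

definition K :: "real \<Rightarrow> (real \<Rightarrow> 'a) \<Rightarrow> real \<Rightarrow> 'a" where
  "K \<tau> g t = integral {..t} (\<lambda>s. R t s (g s)) - integral {t..\<tau>} (\<lambda>s. P t s (g s))"

text \<open>
  The perturbation \<open>\<beta>\<close> is measured by a weighted integral instead of a weighted supremum, so that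
  dominated convergence can be applied to it.
\<close>

context
  fixes \<sigma> \<tau> a b I :: real and g :: "real \<Rightarrow> 'a" and \<beta> :: "real \<Rightarrow> real"
  assumes \<sigma>: "\<rho> < \<sigma>" "\<sigma> < \<gamma>" and ab: "0 \<le> a" "0 \<le> b"
    and g: "continuous_on {..\<tau>} g"
    and gN: "\<And>s. s \<le> \<tau> \<Longrightarrow> nN s (g s) \<le> a * exp (\<sigma> * (\<tau> - s)) + \<beta> s"
    and gS: "\<And>s. s \<le> \<tau> \<Longrightarrow> nS s (g s) \<le> b * exp (\<sigma> * (\<tau> - s)) + \<beta> s"
    and \<beta>: "\<And>s. s \<le> \<tau> \<Longrightarrow> 0 \<le> \<beta> s"
    and int\<beta>: "(\<lambda>s. exp (\<sigma> * (s - \<tau>)) * \<beta> s) integrable_on {..\<tau>}"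
    and I: "integral {..\<tau>} (\<lambda>s. exp (\<sigma> * (s - \<tau>)) * \<beta> s) \<le> I"
begin

lemma weighted_integral_subset:
  assumes "S \<subseteq> {..\<tau>}" "S \<in> sets lebesgue"
  shows "(\<lambda>s. exp (\<sigma> * (s - \<tau>)) * \<beta> s) integrable_on S"
    and "integral S (\<lambda>s. exp (\<sigma> * (s - \<tau>)) * \<beta> s) \<le> I"
proof -
  have "(\<lambda>s. exp (\<sigma> * (s - \<tau>)) * \<beta> s) absolutely_integrable_on {..\<tau>}"
    by (intro nonnegative_absolutely_integrable_1 int\<beta>) (simp add: \<beta>)
  then show *: "(\<lambda>s. exp (\<sigma> * (s - \<tau>)) * \<beta> s) integrable_on S"
    using assms by (intro set_lebesgue_integral_eq_integral(1)) (rule set_integrable_subset)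
  have "integral S (\<lambda>s. exp (\<sigma> * (s - \<tau>)) * \<beta> s) \<le>
      integral {..\<tau>} (\<lambda>s. exp (\<sigma> * (s - \<tau>)) * \<beta> s)"
    by (intro integral_subset_le assms * int\<beta>) (simp add: \<beta>)
  then show "integral S (\<lambda>s. exp (\<sigma> * (s - \<tau>)) * \<beta> s) \<le> I"
    using I by simp
qed

text \<open>The constant \<open>a / (\<sigma> - \<rho>)\<close> is the integral of
  \<open>a * exp (- (\<sigma> - \<rho>) * (s - t))\<close> over all \<open>s \<ge> t\<close>. For
  \<open>\<beta>\<close> the weight with \<open>\<rho>\<close> is enlarged to the one with
  \<open>\<sigma>\<close>, as \<open>s \<ge> t\<close> permits, and then the bound \<open>I\<close>
  applies.\<close>

lemma nN_integral_weighted: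
  assumes t: "t \<le> \<tau>"
  shows "nN t (integral {t..\<tau>} (\<lambda>s. P t s (g s))) \<le> exp (\<sigma> * (\<tau> - t)) * (a / (\<sigma> - \<rho>) + I)"
proof (rule nN_integral[OF t])
  let ?E = "\<lambda>s. exp (\<sigma> * (s - \<tau>)) * \<beta> s"
  let ?w = "\<lambda>s. a * exp ((\<sigma> - \<rho>) * t) * exp (- (\<sigma> - \<rho>) * s)"
  let ?h = "\<lambda>s. exp (\<sigma> * (\<tau> - t)) * (?w s + ?E s)"
  have w_inf: "(?w has_integral a * exp ((\<sigma> - \<rho>) * t) * (exp (- (\<sigma> - \<rho>) * t) / (\<sigma> - \<rho>))) {t..}"
    using \<sigma> by (intro has_integral_mult_right has_integral_exp_minus_to_infinity) simp
  have w: "?w integrable_on {t..\<tau>}"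
    by (intro integrable_continuous_interval continuous_intros)
  have "integral {t..\<tau>} ?w \<le> integral {t..} ?w"
    using ab by (intro integral_subset_le w has_integral_integrable[OF w_inf]) auto
  also have "\<dots> = a / (\<sigma> - \<rho>)"
    unfolding integral_unique[OF w_inf] by (simp flip: exp_add add: algebra_simps)
  finally have w_le: "integral {t..\<tau>} ?w \<le> a / (\<sigma> - \<rho>)" .
  have sub: "{t..\<tau>} \<subseteq> {..\<tau>}" "{t..\<tau>} \<in> sets lebesgue" by auto
  note E = weighted_integral_subset[OF sub]
  show "continuous_on {t..\<tau>} g" by (rule continuous_on_subset[OF g]) auto
  show "?h integrable_on {t..\<tau>}"
    by (intro integrable_on_mult_right integrable_add w E)
  show "integral {t..\<tau>} ?h \<le> exp (\<sigma> * (\<tau> - t)) * (a / (\<sigma> - \<rho>) + I)"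
    by (subst integral_mult_right, subst integral_add[OF w E(1)])
      (intro mult_left_mono add_mono w_le E, simp)
  fix s assume s: "t \<le> s" "s \<le> \<tau>"
  have e1: "exp (\<rho> * (s - t)) * exp (\<sigma> * (\<tau> - s)) =
      exp (\<sigma> * (\<tau> - t)) * (exp ((\<sigma> - \<rho>) * t) * exp (- (\<sigma> - \<rho>) * s))"
    unfolding exp_add[symmetric] by (simp add: algebra_simps)
  have "exp (\<rho> * (s - t)) \<le> exp (\<sigma> * (s - t))"
    using \<sigma> s by (simp add: mult_right_mono)
  also have "\<dots> = exp (\<sigma> * (\<tau> - t)) * exp (\<sigma> * (s - \<tau>))"
    unfolding exp_add[symmetric] by (simp add: algebra_simps)
  finally have e2: "exp (\<rho> * (s - t)) * \<beta> s \<le> exp (\<sigma> * (\<tau> - t)) * exp (\<sigma> * (s - \<tau>)) * \<beta> s"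
    using \<beta>[OF s(2)] by (rule mult_right_mono)
  have "exp (\<rho> * (s - t)) * nN s (g s) \<le>
      exp (\<rho> * (s - t)) * (a * exp (\<sigma> * (\<tau> - s)) + \<beta> s)"
    using gN[OF s(2)] by simp
  also have "\<dots> = a * (exp (\<rho> * (s - t)) * exp (\<sigma> * (\<tau> - s))) + exp (\<rho> * (s - t)) * \<beta> s"
    by (simp add: distrib_left)
  also have "\<dots> \<le> ?h s"
    using e2 unfolding e1 by (simp add: distrib_left)
  finally show "exp (\<rho> * (s - t)) * nN s (g s) \<le> ?h s" .
qed

text \<open>The constant \<open>b / (\<gamma> - \<sigma>)\<close> is the integral of
  \<open>b * exp ((\<gamma> - \<sigma>) * (s - t))\<close> over \<open>s \<le> t\<close>. On this
  side the weight with \<open>\<gamma>\<close> is the smaller one, so it can again be enlarged to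
  the one with \<open>\<sigma>\<close>.\<close>

lemma
  assumes t: "t \<le> \<tau>"
  shows integrable_R_weighted: "(\<lambda>s. R t s (g s)) integrable_on {..t}"
    and nS_integral_weighted:
      "nS t (integral {..t} (\<lambda>s. R t s (g s))) \<le> exp (\<sigma> * (\<tau> - t)) * (b / (\<gamma> - \<sigma>) + I)"
proof -
  let ?E = "\<lambda>s. exp (\<sigma> * (s - \<tau>)) * \<beta> s"
  let ?w = "\<lambda>s. b * exp (- (\<gamma> - \<sigma>) * t) * exp ((\<gamma> - \<sigma>) * s)"
  let ?h = "\<lambda>s. exp (\<sigma> * (\<tau> - t)) * (?w s + ?E s)"
  have w: "(?w has_integral b * exp (- (\<gamma> - \<sigma>) * t) * (exp ((\<gamma> - \<sigma>) * t) / (\<gamma> - \<sigma>))) {..t}"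
    using \<sigma> by (intro has_integral_mult_right has_integral_exp_Iic) simp
  have w_eq: "integral {..t} ?w = b / (\<gamma> - \<sigma>)"
    unfolding integral_unique[OF w] by (simp flip: exp_add add: algebra_simps)
  have sub: "{..t} \<subseteq> {..\<tau>}" "{..t} \<in> sets lebesgue" using t by auto
  note E = weighted_integral_subset[OF sub]
  have gt: "continuous_on {..t} g" by (rule continuous_on_subset[OF g]) (use t in auto)
  have h: "?h integrable_on {..t}"
    by (intro integrable_on_mult_right integrable_add has_integral_integrable[OF w] E)
  have le: "exp (\<gamma> * (s - t)) * nS s (g s) \<le> ?h s" if s: "s \<le> t" for s
  proof -
    have s\<tau>: "s \<le> \<tau>" using s t by simp
    have e1: "exp (\<gamma> * (s - t)) * exp (\<sigma> * (\<tau> - s)) =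
        exp (\<sigma> * (\<tau> - t)) * (exp (- (\<gamma> - \<sigma>) * t) * exp ((\<gamma> - \<sigma>) * s))"
      unfolding exp_add[symmetric] by (simp add: algebra_simps)
    have "exp (\<gamma> * (s - t)) \<le> exp (\<sigma> * (s - t))"
      using \<sigma> s by (simp add: mult_right_mono_neg)
    also have "\<dots> = exp (\<sigma> * (\<tau> - t)) * exp (\<sigma> * (s - \<tau>))"
      unfolding exp_add[symmetric] by (simp add: algebra_simps)
    finally have e2: "exp (\<gamma> * (s - t)) * \<beta> s \<le> exp (\<sigma> * (\<tau> - t)) * exp (\<sigma> * (s - \<tau>)) * \<beta> s"
      using \<beta>[OF s\<tau>] by (rule mult_right_mono)
    have "exp (\<gamma> * (s - t)) * nS s (g s) \<le>
        exp (\<gamma> * (s - t)) * (b * exp (\<sigma> * (\<tau> - s)) + \<beta> s)"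
      using gS[OF s\<tau>] by simp
    also have "\<dots> = b * (exp (\<gamma> * (s - t)) * exp (\<sigma> * (\<tau> - s))) + exp (\<gamma> * (s - t)) * \<beta> s"
      by (simp add: distrib_left)
    also have "\<dots> \<le> ?h s"
      using e2 unfolding e1 by (simp add: distrib_left)
    finally show ?thesis .
  qed
  show "(\<lambda>s. R t s (g s)) integrable_on {..t}"
    by (rule integrable_R[OF gt h le])
  show "nS t (integral {..t} (\<lambda>s. R t s (g s))) \<le> exp (\<sigma> * (\<tau> - t)) * (b / (\<gamma> - \<sigma>) + I)"
  proof (rule nS_integral[OF gt h le])
    show "integral {..t} ?h \<le> exp (\<sigma> * (\<tau> - t)) * (b / (\<gamma> - \<sigma>) + I)"
      by (subst integral_mult_right, subst integral_add[OF has_integral_integrable[OF w] E(1)],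
          subst w_eq) (intro mult_left_mono add_mono order_refl E, simp)
  qed
qed

lemma continuous_on_K: "continuous_on {..\<tau>} (K \<tau> g)"
  unfolding K_def
  by (intro continuous_intros continuous_on_integral_R continuous_on_integral_P g integrable_R_weighted)

text \<open>Each of the two integrals feeds one component only, so \<open>a\<close> and
  \<open>b\<close> enter \<open>\<Gamma>\<close> separately, exactly as in the gap condition. The
  triangle inequality for \<open>\<Gamma>\<close> splits off the perturbation.\<close>

lemma nA_K:
  assumes t: "t \<le> \<tau>"
  shows "nA t (K \<tau> g t) \<le> (\<Gamma> (a / (\<sigma> - \<rho>), b / (\<gamma> - \<sigma>)) + I * \<Gamma> (1, 1)) * exp (\<sigma> * (\<tau> - t))"
proof -
  let ?N = "integral {t..\<tau>} (\<lambda>s. P t s (g s))" and ?S = "integral {..t} (\<lambda>s. R t s (g s))"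
  let ?e = "exp (\<sigma> * (\<tau> - t))"
  have gt: "continuous_on {t..\<tau>} g" by (rule continuous_on_subset[OF g]) auto
  have I0: "0 \<le> I"
    using integral_nonneg[OF int\<beta>] I by (simp add: \<beta>)
  have "nN t (K \<tau> g t) \<le> nN t ?S + nN t ((-1) *\<^sub>R ?N)"
    using nN_add[of t ?S "(-1) *\<^sub>R ?N"] by (simp add: K_def)
  then have N: "nN t (K \<tau> g t) \<le> ?e * (a / (\<sigma> - \<rho>) + I)"
    using nN_scaleR[of t "-1" ?N] nN_integral_weighted[OF t]
      nN_integral_R[OF integrable_R_weighted[OF t]] by simp
  have "nS t (K \<tau> g t) \<le> nS t ?S + nS t ((-1) *\<^sub>R ?N)"
    using nS_add[of t ?S "(-1) *\<^sub>R ?N"] by (simp add: K_def)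
  then have S: "nS t (K \<tau> g t) \<le> ?e * (b / (\<gamma> - \<sigma>) + I)"
    using nS_scaleR[of t "-1" ?N] nS_integral_weighted[OF t] nS_integral_P[OF gt] by simp
  have "nA t (K \<tau> g t) \<le> ?e * \<Gamma> (a / (\<sigma> - \<rho>) + I * 1, b / (\<gamma> - \<sigma>) + I * 1)"
    using nA_leI[OF N S] by (simp add: \<Gamma>_mult)
  also have "\<dots> \<le> ?e * (\<Gamma> (a / (\<sigma> - \<rho>), b / (\<gamma> - \<sigma>)) + \<Gamma> (I * 1, I * 1))"
    by (intro mult_left_mono \<Gamma>_add) auto
  also have "\<dots> = (\<Gamma> (a / (\<sigma> - \<rho>), b / (\<gamma> - \<sigma>)) + I * \<Gamma> (1, 1)) * ?e"
    by (subst \<Gamma>_mult[OF I0]) (rule mult.commute)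
  finally show ?thesis .
qed

end

lemma K_diff:
  assumes t: "t \<le> \<tau>" and g: "continuous_on {..\<tau>} g" "continuous_on {..\<tau>} k"
    and i: "(\<lambda>s. R t s (g s)) integrable_on {..t}" "(\<lambda>s. R t s (k s)) integrable_on {..t}"
  shows "K \<tau> (\<lambda>s. g s - k s) t = K \<tau> g t - K \<tau> k t"
proof -
  have "(\<lambda>s. P t s (g s)) integrable_on {t..\<tau>}" "(\<lambda>s. P t s (k s)) integrable_on {t..\<tau>}"
    by (intro integrable_continuous_interval continuous_on_P_apply continuous_on_subset[OF g(1)]
        continuous_on_subset[OF g(2)]; auto)+
  then show ?thesis
    unfolding K_def blinfun.diff_right by (simp add: integral_diff i)
qed

lemma K_scaleR: "K \<tau> (\<lambda>s. c *\<^sub>R g s) t = c *\<^sub>R K \<tau> g t"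
  unfolding K_def blinfun.scaleR_right by (simp add: scaleR_diff_right)

end

section \<open>Backward orbits\<close>

locale lipschitz_perturbation = weighted_splitting +
  fixes f :: "real \<Rightarrow> 'a \<Rightarrow> 'a" and L1 L2 :: real
  assumes f_cont: "continuous_on UNIV (\<lambda>(t, u). f t u)" and f_zero: "\<And>t. f t 0 = 0"
    and L12: "0 < L1" "0 < L2" and lip: "lipschitz_conditions L Q \<gamma> \<rho> \<Gamma> f L1 L2"
begin

section \<open>Lipschitz bounds and the gap condition\<close>

lemma nN_f: "nN t (f t u - f t v) \<le> L1 * nA t (u - v)"
  using lip unfolding lipschitz_conditions_def nN_def norm_at_eq by blast

lemma nS_f: "nS t (f t u - f t v) \<le> L2 * nA t (u - v)"
  using lip unfolding lipschitz_conditions_def nS_def norm_at_eq by blast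

lemma nN_f_le: "nA t (u - v) \<le> d \<Longrightarrow> nN t (f t u - f t v) \<le> L1 * d"
  by (rule order_trans[OF nN_f mult_left_mono]) (use L12 in auto)

lemma nS_f_le: "nA t (u - v) \<le> d \<Longrightarrow> nS t (f t u - f t v) \<le> L2 * d"
  by (rule order_trans[OF nS_f mult_left_mono]) (use L12 in auto)

lemma continuous_on_f:
  assumes "continuous_on S z"
  shows "continuous_on S (\<lambda>s. f s (z s))"
proof -
  have "continuous_on S (\<lambda>s. (s, z s))" by (intro continuous_intros assms)
  from continuous_on_compose2[OF f_cont this] show ?thesis by simp
qed

definition gap :: "real \<Rightarrow> real" where
  "gap \<sigma> = \<Gamma> (L1 / (\<sigma> - \<rho>), L2 / (\<gamma> - \<sigma>))"

lemma gap_nonneg: "0 \<le> gap \<sigma>"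
  by (simp add: gap_def \<Gamma>_nonneg)

text \<open>Dividing \<open>\<sigma> - \<rho>\<close> by \<open>c > 1\<close> multiplies the first
  argument of \<open>\<Gamma>\<close> by \<open>c\<close> and shrinks the second, so
  \<open>gap \<sigma>' \<le> c * gap \<sigma>\<close> by monotonicity and homogeneity. The choice of
  \<open>c\<close> ensures both \<open>c > 1\<close> and
  \<open>c * gap \<sigma> < 1\<close>.\<close>

lemma gap_below:
  assumes "\<rho> < \<sigma>" "\<sigma> < \<gamma>" "gap \<sigma> < 1"
  obtains \<sigma>' where "\<rho> < \<sigma>'" "\<sigma>' < \<sigma>" "gap \<sigma>' < 1"
proof -
  define c where "c = 2 / (1 + gap \<sigma>)"
  have c: "1 < c" using assms gap_nonneg[of \<sigma>] by (simp add: c_def field_simps)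
  define \<sigma>' where "\<sigma>' = \<rho> + (\<sigma> - \<rho>) / c"
  have "(\<sigma> - \<rho>) / c < \<sigma> - \<rho>" "0 < (\<sigma> - \<rho>) / c"
    using assms c mult_strict_left_mono[of 1 c "\<sigma> - \<rho>"] by (simp_all add: pos_divide_less_eq)
  then have \<sigma>': "\<rho> < \<sigma>'" "\<sigma>' < \<sigma>" by (simp_all add: \<sigma>'_def)
  have "L2 / (\<gamma> - \<sigma>') \<le> L2 / (\<gamma> - \<sigma>)"
    using assms L12 \<sigma>' by (intro divide_left_mono) auto
  also have "\<dots> \<le> c * (L2 / (\<gamma> - \<sigma>))"
    using assms L12 c by (simp add: divide_right_mono)
  finally have "gap \<sigma>' \<le> \<Gamma> (c * (L1 / (\<sigma> - \<rho>)), c * (L2 / (\<gamma> - \<sigma>)))"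
    unfolding gap_def using assms L12 \<sigma>' c
    by (intro \<Gamma>_mono) (auto simp: \<sigma>'_def mult.commute)
  also have "\<dots> = c * gap \<sigma>" unfolding gap_def using c by (intro \<Gamma>_mult) simp
  also have "\<dots> < 1"
    using assms(3) gap_nonneg[of \<sigma>] by (simp add: c_def field_simps)
  finally show ?thesis using that \<sigma>' by blast
qed

text \<open>A bound on the weighted norm that forms no supremum and ignores values after
  \<open>\<tau>\<close>; the constant is carried explicitly.\<close>

definition exp_bounded :: "real \<Rightarrow> real \<Rightarrow> real \<Rightarrow> (real \<Rightarrow> 'a) \<Rightarrow> bool" where
  "exp_bounded \<sigma> \<tau> c z \<longleftrightarrow> (\<forall>t\<le>\<tau>. nA t (z t) \<le> c * exp (\<sigma> * (\<tau> - t)))"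

lemma exp_boundedD: "exp_bounded \<sigma> \<tau> c z \<Longrightarrow> t \<le> \<tau> \<Longrightarrow> nA t (z t) \<le> c * exp (\<sigma> * (\<tau> - t))"
  by (simp add: exp_bounded_def)

lemma exp_bounded_nonneg: "exp_bounded \<sigma> \<tau> c z \<Longrightarrow> 0 \<le> c"
  using exp_boundedD[of \<sigma> \<tau> c z \<tau>] nA_nonneg[of \<tau> "z \<tau>"] by simp

lemma exp_bounded_weaken:
  assumes "exp_bounded \<sigma>' \<tau> c z" "\<sigma>' \<le> \<sigma>"
  shows "exp_bounded \<sigma> \<tau> c z"
  unfolding exp_bounded_def
proof (intro allI impI)
  fix t assume t: "t \<le> \<tau>"
  have "c * exp (\<sigma>' * (\<tau> - t)) \<le> c * exp (\<sigma> * (\<tau> - t))"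
    using assms t exp_bounded_nonneg[OF assms(1)] by (intro mult_left_mono) (auto intro: mult_right_mono)
  then show "nA t (z t) \<le> c * exp (\<sigma> * (\<tau> - t))"
    using exp_boundedD[OF assms(1) t] by simp
qed

lemma exp_bounded_add:
  "exp_bounded \<sigma> \<tau> c z \<Longrightarrow> exp_bounded \<sigma> \<tau> d w \<Longrightarrow> exp_bounded \<sigma> \<tau> (c + d) (\<lambda>t. z t + w t)"
  unfolding exp_bounded_def distrib_right by (meson nA_add add_mono order_trans)

lemma exp_bounded_P: "\<rho> \<le> \<sigma> \<Longrightarrow> exp_bounded \<sigma> \<tau> (C\<^sub>1 * norm \<eta>) (\<lambda>t. P t \<tau> \<eta>)"
  unfolding exp_bounded_def using nA_P by blast

lemma
  assumes \<sigma>: "\<rho> < \<sigma>" "\<sigma> < \<gamma>" and z: "continuous_on {..\<tau>} z" "exp_bounded \<sigma> \<tau> c z"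
  shows integrable_R_f: "t \<le> \<tau> \<Longrightarrow> (\<lambda>s. R t s (f s (z s))) integrable_on {..t}"
    and continuous_on_K_f: "continuous_on {..\<tau>} (K \<tau> (\<lambda>s. f s (z s)))"
proof -
  \<comment> \<open>The summand 0 is the perturbation \<open>\<beta>\<close> of the general
    estimate, absent here.\<close>
  have N: "nN s (f s (z s)) \<le> L1 * c * exp (\<sigma> * (\<tau> - s)) + 0" if "s \<le> \<tau>" for s
    using nN_f_le[of s "z s" 0] exp_boundedD[OF z(2) that] by (simp add: f_zero mult.assoc)
  have S: "nS s (f s (z s)) \<le> L2 * c * exp (\<sigma> * (\<tau> - s)) + 0" if "s \<le> \<tau>" for s
    using nS_f_le[of s "z s" 0] exp_boundedD[OF z(2) that] by (simp add: f_zero mult.assoc)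
  have c: "0 \<le> L1 * c" "0 \<le> L2 * c" using exp_bounded_nonneg[OF z(2)] L12 by auto
  show "(\<lambda>s. R t s (f s (z s))) integrable_on {..t}" if "t \<le> \<tau>"
    by (rule integrable_R_weighted[OF \<sigma> c continuous_on_f[OF z(1)] N S, where I=0])
      (use that in \<open>auto intro: integrable_0\<close>)
  show "continuous_on {..\<tau>} (K \<tau> (\<lambda>s. f s (z s)))"
    by (rule continuous_on_K[OF \<sigma> c continuous_on_f[OF z(1)] N S, where I=0])
      (auto intro: integrable_0)
qed

lemma K_f_diff:
  assumes \<sigma>: "\<rho> < \<sigma>" "\<sigma> < \<gamma>" and z: "continuous_on {..\<tau>} z" "exp_bounded \<sigma> \<tau> cz z"
    and w: "continuous_on {..\<tau>} w" "exp_bounded \<sigma> \<tau> cw w" and t: "t \<le> \<tau>"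
  shows "K \<tau> (\<lambda>s. f s (z s)) t - K \<tau> (\<lambda>s. f s (w s)) t = K \<tau> (\<lambda>s. f s (z s) - f s (w s)) t"
  by (rule K_diff[symmetric])
    (intro t continuous_on_f z w integrable_R_f[OF \<sigma> z] integrable_R_f[OF \<sigma> w])+

text \<open>\<open>L1\<close> and \<open>L2\<close> bound the components separately, and homogeneity
  of \<open>\<Gamma>\<close> extracts \<open>c\<close>; the contraction constant that remains is the
  gap expression.\<close>

lemma exp_bounded_K_f_diff:
  assumes \<sigma>: "\<rho> < \<sigma>" "\<sigma> < \<gamma>" and z: "continuous_on {..\<tau>} z" "exp_bounded \<sigma> \<tau> cz z"
    and w: "continuous_on {..\<tau>} w" "exp_bounded \<sigma> \<tau> cw w"
    and c: "exp_bounded \<sigma> \<tau> c (\<lambda>t. z t - w t)"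
  shows "exp_bounded \<sigma> \<tau> (gap \<sigma> * c) (\<lambda>t. K \<tau> (\<lambda>s. f s (z s)) t - K \<tau> (\<lambda>s. f s (w s)) t)"
  unfolding exp_bounded_def
proof (intro allI impI)
  fix t assume t: "t \<le> \<tau>"
  have c0: "0 \<le> c" by (rule exp_bounded_nonneg[OF c])
  have N: "nN s (f s (z s) - f s (w s)) \<le> L1 * c * exp (\<sigma> * (\<tau> - s)) + 0" if "s \<le> \<tau>" for s
    using nN_f_le[OF exp_boundedD[OF c that]] by (simp add: mult.assoc)
  have S: "nS s (f s (z s) - f s (w s)) \<le> L2 * c * exp (\<sigma> * (\<tau> - s)) + 0" if "s \<le> \<tau>" for s
    using nS_f_le[OF exp_boundedD[OF c that]] by (simp add: mult.assoc)
  have "nA t (K \<tau> (\<lambda>s. f s (z s) - f s (w s)) t) \<le>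
      (\<Gamma> (L1 * c / (\<sigma> - \<rho>), L2 * c / (\<gamma> - \<sigma>)) + 0 * \<Gamma> (1, 1)) * exp (\<sigma> * (\<tau> - t))"
    by (rule nA_K[OF \<sigma> _ _ _ N S])
      (use c0 L12 t in \<open>auto intro!: continuous_intros continuous_on_f z w integrable_0\<close>)
  also have "\<Gamma> (L1 * c / (\<sigma> - \<rho>), L2 * c / (\<gamma> - \<sigma>)) = gap \<sigma> * c"
    using \<Gamma>_mult[OF c0, of "L1 / (\<sigma> - \<rho>)" "L2 / (\<gamma> - \<sigma>)"] by (simp add: gap_def mult.commute)
  finally show "nA t (K \<tau> (\<lambda>s. f s (z s)) t - K \<tau> (\<lambda>s. f s (w s)) t) \<le>
      gap \<sigma> * c * exp (\<sigma> * (\<tau> - t))"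
    by (simp add: K_f_diff[OF \<sigma> z w t])
qed

text \<open>The growth condition is kept apart, so that the same solution can be bounded with
  \<open>\<sigma>'\<close> as well as with \<open>\<sigma>\<close>.\<close>

definition orbit :: "real \<Rightarrow> 'a \<Rightarrow> (real \<Rightarrow> 'a) \<Rightarrow> bool" where
  "orbit \<tau> \<eta> z \<longleftrightarrow> continuous_on {..\<tau>} z \<and>
     (\<forall>t\<le>\<tau>. z t = P t \<tau> \<eta> + K \<tau> (\<lambda>s. f s (z s)) t)"

lemma exp_bounded_contraction:
  assumes bd: "exp_bounded \<sigma> \<tau> c0 z" and q: "q < 1"
    and step: "\<And>c. exp_bounded \<sigma> \<tau> c z \<Longrightarrow> exp_bounded \<sigma> \<tau> (q * c + r) z"
  shows "exp_bounded \<sigma> \<tau> (r / (1 - q)) z"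
proof -
  let ?m = "\<lambda>t. exp (\<sigma> * (t - \<tau>)) * nA t (z t)"
  have m: "exp_bounded \<sigma> \<tau> c z \<longleftrightarrow> (\<forall>t\<in>{..\<tau>}. ?m t \<le> c)" for c
    by (auto simp: exp_bounded_def exp_mult_le_iff)
  have "?m t \<le> r / (1 - q)" if t: "t \<in> {..\<tau>}" for t
  proof (rule bounded_contraction_bound[where m="?m" and S="{..\<tau>}", OF _ q])
    show "bdd_above (?m ` {..\<tau>})" using bd unfolding m by (auto intro: bdd_aboveI2)
    show "0 \<le> ?m t" for t by (simp add: nA_nonneg)
    show "?m t \<le> q * c + r" if "\<And>t. t \<in> {..\<tau>} \<Longrightarrow> ?m t \<le> c" "t \<in> {..\<tau>}" for c t
      using step[of c] that unfolding m by blast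
  qed (rule t)
  then show ?thesis unfolding m by blast
qed

lemma exp_bounded_diff:
  assumes z: "exp_bounded \<sigma> \<tau> c z" and w: "exp_bounded \<sigma> \<tau> d w"
  shows "exp_bounded \<sigma> \<tau> (c + d) (\<lambda>t. z t - w t)"
proof -
  have "exp_bounded \<sigma> \<tau> d (\<lambda>t. - w t)"
    unfolding exp_bounded_def using order_trans[OF nA_minus exp_boundedD[OF w]] by blast
  from exp_bounded_add[OF z this] show ?thesis by simp
qed

text \<open>Serves two purposes: Lipschitz dependence on the initial vector, and uniqueness when
  \<open>\<eta> = \<theta>\<close>. The constants \<open>cz\<close> and \<open>cw\<close> only
  provide the finiteness that the contraction argument starts from.\<close>

lemma orbit_diff_bound:
  assumes \<sigma>: "\<rho> < \<sigma>" "\<sigma> < \<gamma>" and gap: "gap \<sigma> < 1"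
    and z: "orbit \<tau> \<eta> z" "exp_bounded \<sigma> \<tau> cz z"
    and w: "orbit \<tau> \<theta> w" "exp_bounded \<sigma> \<tau> cw w"
  shows "exp_bounded \<sigma> \<tau> (C\<^sub>1 * norm (\<eta> - \<theta>) / (1 - gap \<sigma>)) (\<lambda>t. z t - w t)"
proof (rule exp_bounded_contraction[OF exp_bounded_diff[OF z(2) w(2)] gap])
  have zw: "continuous_on {..\<tau>} z" "continuous_on {..\<tau>} w" using z w by (auto simp: orbit_def)
  fix c assume c: "exp_bounded \<sigma> \<tau> c (\<lambda>t. z t - w t)"
  have "exp_bounded \<sigma> \<tau> (gap \<sigma> * c + C\<^sub>1 * norm (\<eta> - \<theta>))
      (\<lambda>t. (K \<tau> (\<lambda>s. f s (z s)) t - K \<tau> (\<lambda>s. f s (w s)) t) + P t \<tau> (\<eta> - \<theta>))"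
    using \<sigma> by (intro exp_bounded_add exp_bounded_P
        exp_bounded_K_f_diff[OF \<sigma> zw(1) z(2) zw(2) w(2) c]) simp
  moreover have "z t - w t = (K \<tau> (\<lambda>s. f s (z s)) t - K \<tau> (\<lambda>s. f s (w s)) t) + P t \<tau> (\<eta> - \<theta>)"
    if "t \<le> \<tau>" for t
  proof -
    have "z t = P t \<tau> \<eta> + K \<tau> (\<lambda>s. f s (z s)) t" "w t = P t \<tau> \<theta> + K \<tau> (\<lambda>s. f s (w s)) t"
      using z w that unfolding orbit_def by blast+
    then show ?thesis by (simp add: blinfun.diff_right algebra_simps)
  qed
  ultimately show "exp_bounded \<sigma> \<tau> (gap \<sigma> * c + C\<^sub>1 * norm (\<eta> - \<theta>)) (\<lambda>t. z t - w t)"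
    by (simp add: exp_bounded_def)
qed

lemma exp_bounded_norm:
  assumes "exp_bounded \<sigma> \<tau> c z" "t \<le> \<tau>"
  shows "norm (z t) \<le> C\<^sub>2 * c * exp (\<sigma> * (\<tau> - t))"
  using order_trans[OF norm_le_nA mult_left_mono[OF exp_boundedD[OF assms] C2_nonneg]]
  by (simp add: mult.assoc)

lemma orbit_unique:
  assumes \<sigma>: "\<rho> < \<sigma>" "\<sigma> < \<gamma>" and gap: "gap \<sigma> < 1"
    and z: "orbit \<tau> \<eta> z" "exp_bounded \<sigma> \<tau> cz z"
    and w: "orbit \<tau> \<eta> w" "exp_bounded \<sigma> \<tau> cw w" and t: "t \<le> \<tau>"
  shows "z t = w t"
  using exp_bounded_norm[OF orbit_diff_bound[OF \<sigma> gap z w] t] by simp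

text \<open>Picard iteration from zero. The weighted increments decay geometrically with ratio
  \<open>gap \<sigma>\<close>.\<close>

lemma orbit_exists:
  assumes \<sigma>: "\<rho> < \<sigma>" "\<sigma> < \<gamma>" and gap: "gap \<sigma> < 1"
  obtains z c where "orbit \<tau> \<eta> z" "exp_bounded \<sigma> \<tau> c z"
proof -
  let ?\<kappa> = "gap \<sigma>"
  define \<Phi> where "\<Phi> z = (\<lambda>t. P t \<tau> \<eta> + K \<tau> (\<lambda>s. f s (z s)) t)" for z
  define zs where "zs n = (\<Phi> ^^ n) (\<lambda>_. 0)" for n
  have zs_Suc: "zs (Suc n) = \<Phi> (zs n)" for n by (simp add: zs_def)
  have \<Phi>_cont: "continuous_on {..\<tau>} (\<Phi> z)"
    if "continuous_on {..\<tau>} z" "exp_bounded \<sigma> \<tau> c z" for z c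
    unfolding \<Phi>_def
    by (intro continuous_intros continuous_on_P_fst continuous_on_K_f[OF \<sigma> that])
  have \<Phi>_diff: "exp_bounded \<sigma> \<tau> (?\<kappa> * c) (\<lambda>t. \<Phi> z t - \<Phi> w t)"
    if "continuous_on {..\<tau>} z" "exp_bounded \<sigma> \<tau> cz z" "continuous_on {..\<tau>} w"
      "exp_bounded \<sigma> \<tau> cw w" "exp_bounded \<sigma> \<tau> c (\<lambda>t. z t - w t)" for z w cz cw c
    using exp_bounded_K_f_diff[OF \<sigma> that] by (simp add: \<Phi>_def)
  have zs: "continuous_on {..\<tau>} (zs n) \<and> (\<exists>c. exp_bounded \<sigma> \<tau> c (zs n)) \<and>
      exp_bounded \<sigma> \<tau> (?\<kappa> ^ n * (C\<^sub>1 * norm \<eta>)) (\<lambda>t. zs (Suc n) t - zs n t)" for n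
  proof (induction n)
    case 0
    have "nA t 0 \<le> 0" for t using nA_le[of t 0] by simp
    then have "exp_bounded \<sigma> \<tau> 0 (zs 0)" by (simp add: zs_def exp_bounded_def)
    \<comment> \<open>As \<open>f t 0 = 0\<close>, the first increment is the linear orbit, which
      sets the scale \<open>C\<^sub>1 * norm \<eta>\<close> of the geometric bound.\<close>
    moreover have "zs (Suc 0) = (\<lambda>t. P t \<tau> \<eta>)"
      by (simp add: zs_def \<Phi>_def f_zero K_def)
    ultimately show ?case
      using exp_bounded_P[of \<sigma> \<tau> \<eta>] \<sigma> by (auto simp: zs_def)
  next
    case (Suc n)
    then obtain c where c: "exp_bounded \<sigma> \<tau> c (zs n)" by blast
    have cont: "continuous_on {..\<tau>} (zs (Suc n))"
      unfolding zs_Suc using Suc c by (intro \<Phi>_cont) auto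
    obtain c' where c': "exp_bounded \<sigma> \<tau> c' (zs (Suc n))"
      using exp_bounded_add[OF c conjunct2[OF conjunct2[OF Suc]]] by auto
    have "exp_bounded \<sigma> \<tau> (?\<kappa> * (?\<kappa> ^ n * (C\<^sub>1 * norm \<eta>))) (\<lambda>t. \<Phi> (zs (Suc n)) t - \<Phi> (zs n) t)"
      using Suc by (intro \<Phi>_diff[OF cont c' _ c]) auto
    then show ?case using cont c' by (auto simp: zs_Suc mult.assoc)
  qed
  \<comment> \<open>The series is summed after multiplication by the weight, where the M-test gives
    uniform convergence on all of \<open>{..\<tau>}\<close>; \<open>z\<close> removes the weight
    again.\<close>
  define y where "y t = (\<Sum>n. exp (\<sigma> * (t - \<tau>)) *\<^sub>R (zs (Suc n) t - zs n t))" for t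
  define z where "z t = exp (\<sigma> * (\<tau> - t)) *\<^sub>R y t" for t
  have e_inv: "exp (\<sigma> * (\<tau> - t)) * exp (\<sigma> * (t - \<tau>)) = 1" for t
    unfolding exp_add[symmetric] by (simp add: algebra_simps)
  have "uniform_limit {..\<tau>}
      (\<lambda>n t. \<Sum>i<n. exp (\<sigma> * (t - \<tau>)) *\<^sub>R (zs (Suc i) t - zs i t)) y sequentially"
    unfolding y_def
  proof (rule Weierstrass_m_test)
    fix n t assume t: "t \<in> {..\<tau>}"
    have "norm (zs (Suc n) t - zs n t) \<le>
        C\<^sub>2 * (?\<kappa> ^ n * (C\<^sub>1 * norm \<eta>)) * exp (\<sigma> * (\<tau> - t))"
      using exp_bounded_norm[of \<sigma> \<tau> _ "\<lambda>t. zs (Suc n) t - zs n t" t] zs[of n] t by auto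
    then show "norm (exp (\<sigma> * (t - \<tau>)) *\<^sub>R (zs (Suc n) t - zs n t)) \<le>
        C\<^sub>2 * (?\<kappa> ^ n * (C\<^sub>1 * norm \<eta>))"
      by (simp add: exp_mult_le_iff)
  next
    show "summable (\<lambda>n. C\<^sub>2 * (?\<kappa> ^ n * (C\<^sub>1 * norm \<eta>)))"
      using gap gap_nonneg[of \<sigma>] by (intro summable_mult summable_mult2 summable_geometric) simp
  qed
  moreover have "(\<Sum>i<n. exp (\<sigma> * (t - \<tau>)) *\<^sub>R (zs (Suc i) t - zs i t)) =
      exp (\<sigma> * (t - \<tau>)) *\<^sub>R zs n t" for n t
    unfolding scaleR_sum_right[symmetric] sum_lessThan_telescope[of "\<lambda>i. zs i t" n]
    by (simp add: zs_def)
  ultimately have lim: "uniform_limit {..\<tau>} (\<lambda>n t. exp (\<sigma> * (t - \<tau>)) *\<^sub>R zs n t) y sequentially"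
    by simp
  have "continuous_on {..\<tau>} y"
    by (rule uniform_limit_theorem[OF _ lim])
      (auto intro!: always_eventually continuous_intros zs[THEN conjunct1])
  then have z_cont: "continuous_on {..\<tau>} z"
    unfolding z_def by (intro continuous_intros)
  have approx: "\<exists>N. \<forall>n\<ge>N. exp_bounded \<sigma> \<tau> (C\<^sub>1 * \<epsilon>) (\<lambda>t. z t - zs n t)" if \<epsilon>: "\<epsilon> > 0" for \<epsilon>
  proof -
    obtain N where N: "\<And>n t. n \<ge> N \<Longrightarrow> t \<le> \<tau> \<Longrightarrow> dist (exp (\<sigma> * (t - \<tau>)) *\<^sub>R zs n t) (y t) < \<epsilon>"
      using lim \<epsilon> unfolding uniform_limit_iff eventually_sequentially by fastforce
    have "exp_bounded \<sigma> \<tau> (C\<^sub>1 * \<epsilon>) (\<lambda>t. z t - zs n t)" if n: "n \<ge> N" for n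
      unfolding exp_bounded_def
    proof (intro allI impI)
      fix t assume t: "t \<le> \<tau>"
      have "z t - zs n t = exp (\<sigma> * (\<tau> - t)) *\<^sub>R (y t - exp (\<sigma> * (t - \<tau>)) *\<^sub>R zs n t)"
        by (simp add: z_def scaleR_diff_right e_inv)
      then have "norm (z t - zs n t) =
          exp (\<sigma> * (\<tau> - t)) * dist (exp (\<sigma> * (t - \<tau>)) *\<^sub>R zs n t) (y t)"
        by (simp add: dist_norm norm_minus_commute)
      then have "norm (z t - zs n t) \<le> exp (\<sigma> * (\<tau> - t)) * \<epsilon>"
        using N[OF n t] by simp
      from mult_left_mono[OF this C1_nonneg]
      show "nA t (z t - zs n t) \<le> C\<^sub>1 * \<epsilon> * exp (\<sigma> * (\<tau> - t))"
        using nA_le[of t "z t - zs n t"] by (simp add: ac_simps)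
    qed
    then show ?thesis by blast
  qed
  obtain N where N: "exp_bounded \<sigma> \<tau> (C\<^sub>1 * 1) (\<lambda>t. z t - zs N t)" using approx[of 1] by auto
  obtain cN where "exp_bounded \<sigma> \<tau> cN (zs N)" using zs by blast
  from exp_bounded_add[OF N this] obtain cz where cz: "exp_bounded \<sigma> \<tau> cz z" by auto
  have "z t = \<Phi> z t" if t: "t \<le> \<tau>" for t
  proof (rule ccontr)
    assume neq: "z t \<noteq> \<Phi> z t"
    \<comment> \<open>Comparison through an iterate: \<open>zs (Suc n) = \<Phi> (zs n)\<close> is
      close to \<open>z\<close>, and close to \<open>\<Phi> z\<close> by the contraction.
      \<open>A\<close> collects the constants of both estimates and the weight at
      \<open>t\<close>.\<close>
    define A where "A = C\<^sub>2 * C\<^sub>1 * (1 + ?\<kappa>) * exp (\<sigma> * (\<tau> - t))"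
    have le: "norm (z t - \<Phi> z t) \<le> A * \<epsilon>" if \<epsilon>: "\<epsilon> > 0" for \<epsilon>
    proof -
      obtain n where n: "exp_bounded \<sigma> \<tau> (C\<^sub>1 * \<epsilon>) (\<lambda>t. z t - zs (Suc n) t)"
          "exp_bounded \<sigma> \<tau> (C\<^sub>1 * \<epsilon>) (\<lambda>t. z t - zs n t)"
        using approx[OF \<epsilon>] by (meson le_SucI order_refl)
      obtain cn where cn: "exp_bounded \<sigma> \<tau> cn (zs n)" using zs by blast
      have "exp_bounded \<sigma> \<tau> (C\<^sub>1 * \<epsilon> + ?\<kappa> * (C\<^sub>1 * \<epsilon>))
          (\<lambda>t. (z t - zs (Suc n) t) - (\<Phi> z t - \<Phi> (zs n) t))"
        by (intro exp_bounded_diff n \<Phi>_diff[OF z_cont cz _ cn] zs[THEN conjunct1])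
      from exp_bounded_norm[OF this t] show ?thesis
        by (simp add: zs_Suc A_def algebra_simps)
    qed
    have pos: "0 < norm (z t - \<Phi> z t)" using neq by simp
    have "A > 0" using le[of 1] less_le_trans[OF pos] by simp
    \<comment> \<open>For this \<open>\<epsilon>\<close> the upper bound is half of the positive
      norm that it bounds.\<close>
    with pos le[of "norm (z t - \<Phi> z t) / (2 * A)"] show False by simp
  qed
  then have "orbit \<tau> \<eta> z" using z_cont by (simp add: orbit_def \<Phi>_def)
  then show ?thesis using cz that by blast
qed

lemma orbit_equation:
  assumes t: "t \<le> \<tau>"
  shows "ext_process L Q t \<tau> (Q \<tau> \<eta>)
             - integral {t..\<tau>} (\<lambda>s. ext_process L Q t s (Q s (f s (z s))))
             + integral {..t} (\<lambda>s. L t s ((id_blinfun - Q s) (f s (z s)))) =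
         P t \<tau> \<eta> + K \<tau> (\<lambda>s. f s (z s)) t"
proof -
  have "integral {t..\<tau>} (\<lambda>s. ext_process L Q t s (Q s (f s (z s)))) =
      integral {t..\<tau>} (\<lambda>s. P t s (f s (z s)))"
    by (intro integral_cong) (simp add: P_apply)
  then show ?thesis
    using t by (simp add: P_apply K_def R_def)
qed

text \<open>One bounded solution settles the definite description: uniqueness identifies every
  candidate with it on \<open>{..\<tau>}\<close>, and \<open>restrict\<close> selects the
  extensional representative.\<close>

lemma backward_orbit_eq:
  assumes \<sigma>: "\<rho> < \<sigma>" "\<sigma> < \<gamma>" and gap: "gap \<sigma> < 1"
    and z: "orbit \<tau> \<eta> z" "exp_bounded \<sigma> \<tau> c z"
  shows "backward_orbit L Q \<gamma> \<rho> \<Gamma> f \<sigma> \<tau> \<eta> = restrict z {..\<tau>}"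
  unfolding backward_orbit_def
proof (rule the_equality)
  let ?z = "restrict z {..\<tau>}"
  have cont: "continuous_on {..\<tau>} ?z"
    using z(1) unfolding orbit_def by (subst continuous_on_cong[OF refl, where g=z]) auto
  have "bdd_above ((\<lambda>t. exp (\<sigma> * (t - \<tau>)) * norm_at L Q \<gamma> \<rho> \<Gamma> t (?z t)) ` {..\<tau>})"
    by (rule bdd_aboveI2[where M=c])
      (use exp_boundedD[OF z(2)] in \<open>simp add: exp_mult_le_iff norm_at_eq\<close>)
  moreover have "K \<tau> (\<lambda>s. f s (?z s)) t = K \<tau> (\<lambda>s. f s (z s)) t" if "t \<le> \<tau>" for t
    unfolding K_def using that by (intro arg_cong2[where f="(-)"] integral_cong) auto
  ultimately show "?z \<in> E_space L Q \<gamma> \<rho> \<Gamma> \<sigma> \<tau> \<and>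
      (\<forall>t\<le>\<tau>. ?z t = ext_process L Q t \<tau> (Q \<tau> \<eta>)
             - integral {t..\<tau>} (\<lambda>s. ext_process L Q t s (Q s (f s (?z s))))
             + integral {..t} (\<lambda>s. L t s ((id_blinfun - Q s) (f s (?z s)))))"
    using cont z(1) by (simp add: E_space_def orbit_equation orbit_def)
  fix w assume w: "w \<in> E_space L Q \<gamma> \<rho> \<Gamma> \<sigma> \<tau> \<and>
      (\<forall>t\<le>\<tau>. w t = ext_process L Q t \<tau> (Q \<tau> \<eta>)
             - integral {t..\<tau>} (\<lambda>s. ext_process L Q t s (Q s (f s (w s))))
             + integral {..t} (\<lambda>s. L t s ((id_blinfun - Q s) (f s (w s)))))"
  have ow: "orbit \<tau> \<eta> w"
    unfolding orbit_def using w by (simp add: E_space_def orbit_equation)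
  obtain cw where "\<And>t. t \<le> \<tau> \<Longrightarrow> exp (\<sigma> * (t - \<tau>)) * nA t (w t) \<le> cw"
    using conjunct1[OF w] unfolding E_space_def bdd_above_def norm_at_eq by auto
  then have "exp_bounded \<sigma> \<tau> cw w" by (simp add: exp_bounded_def exp_mult_le_iff)
  from orbit_unique[OF \<sigma> gap ow this z] have "w t = z t" if "t \<le> \<tau>" for t using that by blast
  moreover have "w \<in> extensional {..\<tau>}" using w by (simp add: E_space_def)
  ultimately show "w = ?z"
    by (intro extensionalityI[of _ "{..\<tau>}"]) auto
qed

section \<open>Difference quotients\<close>

context
  fixes \<sigma> \<sigma>' \<tau> :: real and zz :: "'a \<Rightarrow> real \<Rightarrow> 'a"
  assumes \<sigma>': "\<rho> < \<sigma>'" "\<sigma>' < \<sigma>" and \<sigma>: "\<sigma> < \<gamma>" and gap: "gap \<sigma> < 1" and gap': "gap \<sigma>' < 1"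
    and zz: "\<And>\<eta>. orbit \<tau> \<eta> (zz \<eta>)" and zz_bounded: "\<And>\<eta>. \<exists>c. exp_bounded \<sigma>' \<tau> c (zz \<eta>)"
begin

lemma \<sigma>_bounds: "\<rho> < \<sigma>" "\<sigma>' < \<gamma>"
  using \<sigma> \<sigma>' by auto

section \<open>Difference quotients of the orbits and of the nonlinearity\<close>

lemma continuous_on_zz: "continuous_on {..\<tau>} (zz \<eta>)"
  using zz by (simp add: orbit_def)

lemma zz_diff_bound: "exp_bounded \<sigma>' \<tau> (C\<^sub>1 * norm (\<eta> - \<theta>) / (1 - gap \<sigma>')) (\<lambda>t. zz \<eta> t - zz \<theta> t)"
proof -
  obtain c d where "exp_bounded \<sigma>' \<tau> c (zz \<eta>)" "exp_bounded \<sigma>' \<tau> d (zz \<theta>)"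
    using zz_bounded by blast
  then show ?thesis
    by (rule orbit_diff_bound[OF \<sigma>'(1) \<sigma>_bounds(2) gap' zz _ zz])
qed

definition dq :: "'a \<Rightarrow> real \<Rightarrow> 'a \<Rightarrow> real \<Rightarrow> 'a" where
  "dq u s h r = (zz (u + s *\<^sub>R h) r - zz u r) /\<^sub>R s"

text \<open>The direction \<open>x\<close> is arbitrary, so that quotients with different base
  points and steps can be compared in the same direction; inserting \<open>dq\<close> gives back the
  quotient of \<open>f\<close> along two orbits.\<close>

definition df :: "'a \<Rightarrow> real \<Rightarrow> 'a \<Rightarrow> real \<Rightarrow> 'a" where
  "df u s x r = (f r (zz u r + s *\<^sub>R x) - f r (zz u r)) /\<^sub>R s"

lemma zz_dq: "s \<noteq> 0 \<Longrightarrow> zz u r + s *\<^sub>R dq u s h r = zz (u + s *\<^sub>R h) r"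
  by (simp add: dq_def)

lemma df_dq:
  "s \<noteq> 0 \<Longrightarrow> df u s (dq u s h r) r = (f r (zz (u + s *\<^sub>R h) r) - f r (zz u r)) /\<^sub>R s"
  by (simp add: df_def zz_dq)

lemma continuous_on_dq: "continuous_on {..\<tau>} (dq u s h)"
  unfolding dq_def by (intro continuous_intros continuous_on_zz)

lemma continuous_on_df: "continuous_on {..\<tau>} x \<Longrightarrow> continuous_on {..\<tau>} (\<lambda>r. df u s (x r) r)"
  unfolding df_def by (intro continuous_intros continuous_on_f continuous_on_zz)

text \<open>Lipschitz dependence of the orbits divided by the step, hence uniform in
  \<open>u\<close> and \<open>s\<close>. The bound uses \<open>\<sigma>'\<close>, and the distance
  to \<open>\<sigma>\<close> later yields an integrable majorant.\<close>

lemma dq_bounded: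
  assumes s: "s \<noteq> 0" and h: "norm h \<le> B"
  shows "exp_bounded \<sigma>' \<tau> (C\<^sub>1 * B / (1 - gap \<sigma>')) (dq u s h)"
  unfolding exp_bounded_def
proof (intro allI impI)
  fix r assume r: "r \<le> \<tau>"
  let ?e = "exp (\<sigma>' * (\<tau> - r))"
  have "nA r (dq u s h r) \<le> \<bar>inverse s\<bar> * nA r (zz (u + s *\<^sub>R h) r - zz u r)"
    unfolding dq_def by (rule nA_scaleR)
  also have "\<dots> \<le> \<bar>inverse s\<bar> * (C\<^sub>1 * norm (u + s *\<^sub>R h - u) / (1 - gap \<sigma>') * ?e)"
    by (intro mult_left_mono exp_boundedD[OF zz_diff_bound r]) auto
  also have "\<dots> = C\<^sub>1 * norm h / (1 - gap \<sigma>') * ?e"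
    using s by (simp add: field_simps)
  also have "\<dots> \<le> C\<^sub>1 * B / (1 - gap \<sigma>') * ?e"
    using h gap' C1_nonneg by (intro mult_right_mono divide_right_mono mult_left_mono) auto
  finally show "nA r (dq u s h r) \<le> C\<^sub>1 * B / (1 - gap \<sigma>') * ?e" .
qed

text \<open>Two orbit equations are subtracted and divided by \<open>s\<close>; the linear term
  becomes \<open>P r \<tau> h\<close>, free of \<open>u\<close> and \<open>s\<close>.\<close>

lemma
  assumes s: "s \<noteq> 0" and r: "r \<le> \<tau>"
  shows integrable_df_dq: "(\<lambda>q. R r q (df u s (dq u s h q) q)) integrable_on {..r}"
    and dq_eq: "dq u s h r = P r \<tau> h + K \<tau> (\<lambda>q. df u s (dq u s h q) q) r"
proof -
  let ?v = "u + s *\<^sub>R h"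
  obtain c d where c: "exp_bounded \<sigma>' \<tau> c (zz ?v)" and d: "exp_bounded \<sigma>' \<tau> d (zz u)"
    using zz_bounded by blast
  have "(\<lambda>q. (R r q (f q (zz ?v q)) - R r q (f q (zz u q))) /\<^sub>R s) integrable_on {..r}"
    by (intro integrable_cmul integrable_diff integrable_R_f[OF \<sigma>'(1) \<sigma>_bounds(2) continuous_on_zz c r]
        integrable_R_f[OF \<sigma>'(1) \<sigma>_bounds(2) continuous_on_zz d r])
  then show "(\<lambda>q. R r q (df u s (dq u s h q) q)) integrable_on {..r}"
    by (simp add: df_dq s blinfun.diff_right blinfun.scaleR_right)
  have eq: "zz ?v r = P r \<tau> ?v + K \<tau> (\<lambda>q. f q (zz ?v q)) r"
    "zz u r = P r \<tau> u + K \<tau> (\<lambda>q. f q (zz u q)) r"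
    using zz r unfolding orbit_def by blast+
  have "zz ?v r - zz u r =
      s *\<^sub>R P r \<tau> h + (K \<tau> (\<lambda>q. f q (zz ?v q)) r - K \<tau> (\<lambda>q. f q (zz u q)) r)"
    unfolding eq(1) eq(2) by (simp add: blinfun.add_right blinfun.scaleR_right)
  also have "K \<tau> (\<lambda>q. f q (zz ?v q)) r - K \<tau> (\<lambda>q. f q (zz u q)) r =
      K \<tau> (\<lambda>q. f q (zz ?v q) - f q (zz u q)) r"
    by (rule K_f_diff[OF \<sigma>'(1) \<sigma>_bounds(2) continuous_on_zz c continuous_on_zz d r])
  finally have "dq u s h r = P r \<tau> h + (1 / s) *\<^sub>R K \<tau> (\<lambda>q. f q (zz ?v q) - f q (zz u q)) r"
    unfolding dq_def using s by (simp add: scaleR_add_right divide_inverse)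
  then show "dq u s h r = P r \<tau> h + K \<tau> (\<lambda>q. df u s (dq u s h q) q) r"
    by (simp add: df_dq s divide_inverse flip: K_scaleR)
qed

text \<open>The step cancels, so \<open>df\<close> inherits the Lipschitz constants of
  \<open>f\<close> in its direction argument, whatever the base point and step.\<close>

lemma
  assumes s: "s \<noteq> 0"
  shows nN_df: "nN r (df u s x r - df u s y r) \<le> L1 * nA r (x - y)"
    and nS_df: "nS r (df u s x r - df u s y r) \<le> L2 * nA r (x - y)"
proof -
  let ?a = "zz u r + s *\<^sub>R x" and ?b = "zz u r + s *\<^sub>R y"
  have eq: "df u s x r - df u s y r = inverse s *\<^sub>R (f r ?a - f r ?b)"
    unfolding df_def by (simp add: scaleR_diff_right)
  have ab: "nA r (?a - ?b) \<le> \<bar>s\<bar> * nA r (x - y)"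
    using nA_scaleR[of r s "x - y"] by (simp add: scaleR_diff_right)
  have cancel: "\<bar>inverse s\<bar> * (a * (\<bar>s\<bar> * b)) = a * b" for a b
    using s by (simp add: field_simps)
  have "nN r (df u s x r - df u s y r) \<le> \<bar>inverse s\<bar> * (L1 * (\<bar>s\<bar> * nA r (x - y)))"
    unfolding eq by (rule order_trans[OF nN_scaleR mult_left_mono[OF nN_f_le[OF ab]]]) simp
  then show "nN r (df u s x r - df u s y r) \<le> L1 * nA r (x - y)"
    unfolding cancel .
  have "nS r (df u s x r - df u s y r) \<le> \<bar>inverse s\<bar> * (L2 * (\<bar>s\<bar> * nA r (x - y)))"
    unfolding eq by (rule order_trans[OF nS_scaleR mult_left_mono[OF nS_f_le[OF ab]]]) simp
  then show "nS r (df u s x r - df u s y r) \<le> L2 * nA r (x - y)"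
    unfolding cancel .
qed

lemma norm_df: "s \<noteq> 0 \<Longrightarrow> norm (df u s x r) \<le> (L1 + L2) * nA r x"
  using nN_df[of s r u x 0] nS_df[of s r u x 0] norm_le_nN_nS[of "df u s x r" r]
  by (simp add: df_def[of u s 0] distrib_right)

text \<open>
  The linear part of the equation for the difference quotients depends on the direction \<open>h\<close> only, so
  two quotients in the same direction differ by a contraction plus a remainder of \<open>f\<close>.
\<close>

lemma dq_diff_bound:
  assumes s: "s \<noteq> 0" and t: "t \<noteq> 0"
    and e: "\<And>r. e r = df u s (dq v t h r) r - df v t (dq v t h r) r"
    and i: "(\<lambda>r. exp (\<sigma> * (r - \<tau>)) * (M * norm (e r))) integrable_on {..\<tau>}"
    and I: "integral {..\<tau>} (\<lambda>r. exp (\<sigma> * (r - \<tau>)) * (M * norm (e r))) \<le> I"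
  shows "exp_bounded \<sigma> \<tau> (I * \<Gamma> (1, 1) / (1 - gap \<sigma>)) (\<lambda>r. dq u s h r - dq v t h r)"
proof (rule exp_bounded_contraction[OF _ gap])
  \<comment> \<open>Some finite bound to start from; its size does not enter the result.\<close>
  show "exp_bounded \<sigma> \<tau>
      (C\<^sub>1 * norm h / (1 - gap \<sigma>') + C\<^sub>1 * norm h / (1 - gap \<sigma>')) (\<lambda>r. dq u s h r - dq v t h r)"
    using \<sigma>' s t by (intro exp_bounded_diff exp_bounded_weaken[OF dq_bounded]) auto
  fix c assume c: "exp_bounded \<sigma> \<tau> c (\<lambda>r. dq u s h r - dq v t h r)"
  have c0: "0 \<le> c" by (rule exp_bounded_nonneg[OF c])
  let ?g = "\<lambda>r. df u s (dq u s h r) r - df v t (dq v t h r) r"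
  \<comment> \<open>Same base point with two directions, controlled by the Lipschitz constants, plus
    same direction with two base points, which is the remainder.\<close>
  have g_eq: "?g r = (df u s (dq u s h r) r - df u s (dq v t h r) r) + e r" for r
    by (simp add: e)
  have N: "nN r (?g r) \<le> L1 * c * exp (\<sigma> * (\<tau> - r)) + M * norm (e r)" if r: "r \<le> \<tau>" for r
  proof -
    have "nN r (df u s (dq u s h r) r - df u s (dq v t h r) r) \<le> L1 * (c * exp (\<sigma> * (\<tau> - r)))"
      using L12 by (intro order_trans[OF nN_df[OF s] mult_left_mono[OF exp_boundedD[OF c r]]]) simp
    then show ?thesis
      unfolding g_eq mult.assoc by (intro order_trans[OF nN_add] add_mono nN_le)
  qed
  have S: "nS r (?g r) \<le> L2 * c * exp (\<sigma> * (\<tau> - r)) + M * norm (e r)" if r: "r \<le> \<tau>" for r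
  proof -
    have "nS r (df u s (dq u s h r) r - df u s (dq v t h r) r) \<le> L2 * (c * exp (\<sigma> * (\<tau> - r)))"
      using L12 by (intro order_trans[OF nS_df[OF s] mult_left_mono[OF exp_boundedD[OF c r]]]) simp
    then show ?thesis
      unfolding g_eq mult.assoc by (intro order_trans[OF nS_add] add_mono nS_le)
  qed
  show "exp_bounded \<sigma> \<tau> (gap \<sigma> * c + I * \<Gamma> (1, 1)) (\<lambda>r. dq u s h r - dq v t h r)"
    unfolding exp_bounded_def
  proof (intro allI impI)
    fix r assume r: "r \<le> \<tau>"
    have cont: "continuous_on {..\<tau>} (\<lambda>r. df u s (dq u s h r) r)"
      "continuous_on {..\<tau>} (\<lambda>r. df v t (dq v t h r) r)"
      by (intro continuous_on_df continuous_on_dq)+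
    have "nA r (K \<tau> ?g r) \<le>
        (\<Gamma> (L1 * c / (\<sigma> - \<rho>), L2 * c / (\<gamma> - \<sigma>)) + I * \<Gamma> (1, 1)) * exp (\<sigma> * (\<tau> - r))"
      by (rule nA_K[OF \<sigma>_bounds(1) \<sigma> _ _ _ N S _ i I r])
        (use c0 L12 M_ge_1 in \<open>auto intro!: continuous_intros cont\<close>)
    also have "\<Gamma> (L1 * c / (\<sigma> - \<rho>), L2 * c / (\<gamma> - \<sigma>)) = gap \<sigma> * c"
      using \<Gamma>_mult[OF c0, of "L1 / (\<sigma> - \<rho>)" "L2 / (\<gamma> - \<sigma>)"] by (simp add: gap_def mult.commute)
    also have "K \<tau> ?g r = dq u s h r - dq v t h r"
      unfolding dq_eq[OF s r] dq_eq[OF t r]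
      by (simp add: K_diff[OF r cont integrable_df_dq[OF s r] integrable_df_dq[OF t r]])
    finally show "nA r (dq u s h r - dq v t h r) \<le>
        (gap \<sigma> * c + I * \<Gamma> (1, 1)) * exp (\<sigma> * (\<tau> - r))" .
  qed
qed

text \<open>Both quotients are compared with \<open>Df r (zz \<eta> r) (x n)\<close>. The directions
  need not converge and the base points \<open>zz (u n) r\<close> move, so the derivative at
  \<open>zz \<eta> r\<close> is used in its strict form.\<close>

lemma remainder_tendsto_0:
  fixes Df :: "real \<Rightarrow> 'a \<Rightarrow> 'a \<Rightarrow>\<^sub>L 'a"
  assumes der: "\<And>t u. (f t has_derivative blinfun_apply (Df t u)) (at u)"
    and Df: "\<And>t u0. ((\<lambda>u. norm (Df t u - Df t u0)) \<longlongrightarrow> 0) (at u0)"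
    and u: "u \<longlonglongrightarrow> \<eta>" and v: "v \<longlonglongrightarrow> \<eta>" and s: "s \<longlonglongrightarrow> 0" "\<And>n. s n \<noteq> 0" and t: "t \<longlonglongrightarrow> 0" "\<And>n. t n \<noteq> 0"
    and x: "\<And>n. norm (x n) \<le> B" and r: "r \<le> \<tau>"
  shows "(\<lambda>n. df (u n) (s n) (x n) r - df (v n) (t n) (x n) r) \<longlonglongrightarrow> 0"
proof -
  have B: "0 \<le> B" using x[of 0] norm_ge_zero order_trans by blast
  have half: "(\<lambda>n. df (u n) (s n) (x n) r - Df r (zz \<eta> r) (x n)) \<longlonglongrightarrow> 0"
    if u: "u \<longlonglongrightarrow> \<eta>" and s: "s \<longlonglongrightarrow> 0" "\<And>n. s n \<noteq> 0" for u s
  proof (rule tendstoI)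
    fix e :: real assume e: "e > 0"
    \<comment> \<open>Chosen so that \<open>e' * B < e\<close>; the summand 1 covers
      \<open>B = 0\<close>.\<close>
    define e' where "e' = e / 2 / (B + 1)"
    have "x / (B + 1) * (B + 1) = x" for x using B by simp
    then have "e' * (B + 1) = e / 2" unfolding e'_def .
    moreover have "e' > 0" using e B by (simp add: e'_def)
    ultimately have e': "e' > 0" "e' * B < e" using e by (simp_all add: distrib_left)
    obtain d where d: "d > 0"
      "\<And>a b. norm (a - zz \<eta> r) < d \<Longrightarrow> norm (b - zz \<eta> r) < d \<Longrightarrow>
         norm (f r b - f r a - Df r (zz \<eta> r) (b - a)) \<le> e' * norm (b - a)"
      using has_derivative_strict[OF der Df e'(1)] by metis
    let ?C = "C\<^sub>2 * (C\<^sub>1 / (1 - gap \<sigma>')) * exp (\<sigma>' * (\<tau> - r))"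
    have zz_lip: "norm (zz a r - zz \<eta> r) \<le> ?C * norm (a - \<eta>)" for a
      using exp_bounded_norm[OF zz_diff_bound r, of a \<eta>] by (simp add: ac_simps)
    have "(\<lambda>n. ?C * norm (u n - \<eta>)) \<longlonglongrightarrow> ?C * norm (\<eta> - \<eta>)"
      by (intro tendsto_intros u)
    then have "\<forall>\<^sub>F n in sequentially. ?C * norm (u n - \<eta>) < d / 2"
      using d(1) by (intro order_tendstoD(2)[of _ 0]) auto
    moreover have "(\<lambda>n. \<bar>s n\<bar> * B) \<longlonglongrightarrow> \<bar>0\<bar> * B"
      by (intro tendsto_intros s)
    then have "\<forall>\<^sub>F n in sequentially. \<bar>s n\<bar> * B < d / 2"
      using d(1) by (intro order_tendstoD(2)[of _ 0]) auto
    ultimately show "\<forall>\<^sub>F n in sequentially. dist (df (u n) (s n) (x n) r - Df r (zz \<eta> r) (x n)) 0 < e"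
    proof eventually_elim
      case (elim n)
      \<comment> \<open>Both ends of the increment lie within \<open>d\<close> of
        \<open>zz \<eta> r\<close>: half of the distance is spent on the moving base point, half on
        the step.\<close>
      let ?a = "zz (u n) r" and ?b = "zz (u n) r + s n *\<^sub>R x n"
      have a: "norm (?a - zz \<eta> r) < d / 2" by (rule le_less_trans[OF zz_lip elim(1)])
      have "norm (s n *\<^sub>R x n) \<le> \<bar>s n\<bar> * B" using x[of n] by (simp add: mult_left_mono)
      then have sx: "norm (s n *\<^sub>R x n) < d / 2" using elim(2) by linarith
      have b: "norm (?b - zz \<eta> r) < d"
        using norm_triangle_ineq[of "?a - zz \<eta> r" "s n *\<^sub>R x n"] a sx by (simp add: algebra_simps)
      have "norm (f r ?b - f r ?a - Df r (zz \<eta> r) (?b - ?a)) \<le> e' * norm (?b - ?a)"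
        using a b d(1) by (intro d(2)) auto
      then have le: "norm (f r ?b - f r ?a - s n *\<^sub>R Df r (zz \<eta> r) (x n)) \<le> \<bar>s n\<bar> * (e' * norm (x n))"
        by (simp add: blinfun.scaleR_right mult.left_commute)
      have "df (u n) (s n) (x n) r - Df r (zz \<eta> r) (x n) =
          inverse (s n) *\<^sub>R (f r ?b - f r ?a - s n *\<^sub>R Df r (zz \<eta> r) (x n))"
        using s(2)[of n] by (simp add: df_def scaleR_diff_right)
      then have "norm (df (u n) (s n) (x n) r - Df r (zz \<eta> r) (x n)) =
          \<bar>inverse (s n)\<bar> * norm (f r ?b - f r ?a - s n *\<^sub>R Df r (zz \<eta> r) (x n))"
        by (simp only: norm_scaleR)
      also have "\<dots> \<le> \<bar>inverse (s n)\<bar> * (\<bar>s n\<bar> * (e' * norm (x n)))"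
        by (intro mult_left_mono le) simp
      also have "\<dots> = e' * norm (x n)" using s(2)[of n] by simp
      also have "\<dots> \<le> e' * B" using x[of n] e'(1) by simp
      finally show ?case using e'(2) by simp
    qed
  qed
  from tendsto_diff[OF half[OF u s] half[OF v t]] show ?thesis by simp
qed

text \<open>Dominated convergence: \<open>norm_df\<close> and \<open>dq_bounded\<close> bound the
  remainder by a multiple of \<open>exp (\<sigma>' * (\<tau> - r))\<close> with a factor independent
  of \<open>n\<close>, which the weight with the larger exponent makes integrable.\<close>

lemma remainder_integral_tendsto_0:
  fixes Df :: "real \<Rightarrow> 'a \<Rightarrow> 'a \<Rightarrow>\<^sub>L 'a"
  assumes der: "\<And>t u. (f t has_derivative blinfun_apply (Df t u)) (at u)"
    and Df: "\<And>t u0. ((\<lambda>u. norm (Df t u - Df t u0)) \<longlongrightarrow> 0) (at u0)"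
    and u: "u \<longlonglongrightarrow> \<eta>" and v: "v \<longlonglongrightarrow> \<eta>" and s: "s \<longlonglongrightarrow> 0" "\<And>n. s n \<noteq> 0" and t: "t \<longlonglongrightarrow> 0" "\<And>n. t n \<noteq> 0"
    and h: "\<And>n. norm (h n) \<le> B"
    and e: "\<And>n r. e n r = df (u n) (s n) (dq (v n) (t n) (h n) r) r -
      df (v n) (t n) (dq (v n) (t n) (h n) r) r"
  shows "(\<lambda>r. exp (\<sigma> * (r - \<tau>)) * (M * norm (e n r))) integrable_on {..\<tau>}"
    and "(\<lambda>n. integral {..\<tau>} (\<lambda>r. exp (\<sigma> * (r - \<tau>)) * (M * norm (e n r)))) \<longlonglongrightarrow> 0"
proof -
  let ?B = "C\<^sub>1 * B / (1 - gap \<sigma>')"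
  let ?D = "M * (2 * ((L1 + L2) * ?B))"
  let ?F = "\<lambda>n r. exp (\<sigma> * (r - \<tau>)) * (M * norm (e n r))"
  \<comment> \<open>The majorant \<open>?D * exp (- (\<sigma> - \<sigma>') * (\<tau> - r))\<close>,
    factored to match the integral of an exponential.\<close>
  let ?H = "\<lambda>r. ?D * exp (- (\<sigma> - \<sigma>') * \<tau>) * exp ((\<sigma> - \<sigma>') * r)"
  have H: "?H integrable_on {..\<tau>}"
    using \<sigma>' by (intro integrable_on_mult_right has_integral_integrable[OF has_integral_exp_Iic]) simp
  have bd: "exp_bounded \<sigma>' \<tau> ?B (dq (v n) (t n) (h n))" for n
    by (rule dq_bounded[OF t(2) h])
  have le: "norm (?F n r) \<le> ?H r" if r: "r \<le> \<tau>" for n r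
  proof -
    let ?w = "dq (v n) (t n) (h n) r"
    have "norm (e n r) \<le> norm (df (u n) (s n) ?w r) + norm (df (v n) (t n) ?w r)"
      unfolding e by (rule norm_triangle_ineq4)
    also have "\<dots> \<le> (L1 + L2) * nA r ?w + (L1 + L2) * nA r ?w"
      by (intro add_mono norm_df s t)
    also have "\<dots> = 2 * ((L1 + L2) * nA r ?w)" by simp
    also have "\<dots> \<le> 2 * ((L1 + L2) * (?B * exp (\<sigma>' * (\<tau> - r))))"
      using L12 by (intro mult_left_mono exp_boundedD[OF bd r]) auto
    finally have "?F n r \<le> exp (\<sigma> * (r - \<tau>)) * (M * (2 * ((L1 + L2) * (?B * exp (\<sigma>' * (\<tau> - r))))))"
      using M_ge_1 by (intro mult_left_mono) auto
    also have "\<dots> = ?D * (exp (\<sigma> * (r - \<tau>)) * exp (\<sigma>' * (\<tau> - r)))"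
      by (simp add: ac_simps)
    also have "exp (\<sigma> * (r - \<tau>)) * exp (\<sigma>' * (\<tau> - r)) =
        exp (- (\<sigma> - \<sigma>') * \<tau>) * exp ((\<sigma> - \<sigma>') * r)"
      unfolding exp_add[symmetric] by (simp add: algebra_simps)
    finally show ?thesis using M_ge_1 by (simp add: mult.assoc)
  qed
  have cont: "continuous_on {..\<tau>} (?F n)" for n
    unfolding e by (intro continuous_intros continuous_on_df continuous_on_dq)
  show int: "?F n integrable_on {..\<tau>}" for n
    by (rule integrable_Iic_continuous_bound[OF cont le H])
  have "(\<lambda>n. integral {..\<tau>} (?F n)) \<longlonglongrightarrow> integral {..\<tau>} (\<lambda>r. 0)"
  proof (rule dominated_convergence(2)[OF int H])
    show "norm (?F n r) \<le> ?H r" if "r \<in> {..\<tau>}" for n r using le that by simp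
    fix r assume "r \<in> {..\<tau>}"
    then have r: "r \<le> \<tau>" by simp
    have "(\<lambda>n. e n r) \<longlonglongrightarrow> 0"
      unfolding e by (rule remainder_tendsto_0[OF der Df u v s t exp_bounded_norm[OF bd r] r])
    then have "(\<lambda>n. ?F n r) \<longlonglongrightarrow> exp (\<sigma> * (r - \<tau>)) * (M * norm (0 :: 'a))"
      by (intro tendsto_intros)
    then show "(\<lambda>n. ?F n r) \<longlonglongrightarrow> 0" by simp
  qed
  then show "(\<lambda>n. integral {..\<tau>} (?F n)) \<longlonglongrightarrow> 0" by simp
qed

text \<open>A failure of uniformity yields sequences of base points, steps and bounded directions.
  Along these the weighted integral of the remainder tends to zero, and \<open>dq_diff_bound\<close>
  passes this on to the quotients.\<close>

lemma dq_Cauchy: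
  fixes Df :: "real \<Rightarrow> 'a \<Rightarrow> 'a \<Rightarrow>\<^sub>L 'a" and \<eta> :: 'a and B \<epsilon> :: real
  assumes der: "\<And>t u. (f t has_derivative blinfun_apply (Df t u)) (at u)"
    and Df: "\<And>t u0. ((\<lambda>u. norm (Df t u - Df t u0)) \<longlongrightarrow> 0) (at u0)"
    and \<epsilon>: "\<epsilon> > 0"
  shows "\<exists>d>0. \<forall>u v h s t. norm (u - \<eta>) < d \<longrightarrow> norm (v - \<eta>) < d \<longrightarrow>
      s \<noteq> 0 \<longrightarrow> \<bar>s\<bar> < d \<longrightarrow> t \<noteq> 0 \<longrightarrow> \<bar>t\<bar> < d \<longrightarrow> norm h \<le> B \<longrightarrow>
      norm (dq u s h \<tau> - dq v t h \<tau>) \<le> \<epsilon>"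
proof (rule ccontr)
  define d :: "nat \<Rightarrow> real" where "d n = 1 / (real n + 1)" for n
  have d0: "d \<longlonglongrightarrow> 0" unfolding d_def by real_asymp
  assume "\<not> ?thesis"
  then have "\<exists>u v h s t. norm (u - \<eta>) < d n \<and> norm (v - \<eta>) < d n \<and> s \<noteq> 0 \<and> \<bar>s\<bar> < d n \<and>
      t \<noteq> 0 \<and> \<bar>t\<bar> < d n \<and> norm h \<le> B \<and> \<not> norm (dq u s h \<tau> - dq v t h \<tau>) \<le> \<epsilon>" for n
    by (auto simp: d_def)
  then obtain u v h s t where *: "\<And>n. norm (u n - \<eta>) < d n \<and> norm (v n - \<eta>) < d n \<and> s n \<noteq> 0 \<and>
      \<bar>s n\<bar> < d n \<and> t n \<noteq> 0 \<and> \<bar>t n\<bar> < d n \<and> norm (h n) \<le> B \<and>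
      \<not> norm (dq (u n) (s n) (h n) \<tau> - dq (v n) (t n) (h n) \<tau>) \<le> \<epsilon>"
    by metis
  have lim: "a \<longlonglongrightarrow> l" if "\<And>n. norm (a n - l) < d n" for a :: "nat \<Rightarrow> 'b::real_normed_vector" and l
    by (rule LIM_zero_cancel, rule Lim_null_comparison[OF _ d0])
      (use that in \<open>auto intro: always_eventually less_imp_le\<close>)
  have u: "u \<longlonglongrightarrow> \<eta>" and v: "v \<longlonglongrightarrow> \<eta>" and s: "s \<longlonglongrightarrow> 0" and t: "t \<longlonglongrightarrow> 0"
    using * by (auto intro!: lim)
  have nz: "s n \<noteq> 0" "t n \<noteq> 0" "norm (h n) \<le> B" for n using * by auto
  define e where "e n r = df (u n) (s n) (dq (v n) (t n) (h n) r) r -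
      df (v n) (t n) (dq (v n) (t n) (h n) r) r" for n r
  let ?I = "\<lambda>n. integral {..\<tau>} (\<lambda>r. exp (\<sigma> * (r - \<tau>)) * (M * norm (e n r)))"
  note e_int = remainder_integral_tendsto_0[OF der Df u v s nz(1) t nz(2) nz(3) e_def]
  have "(\<lambda>n. C\<^sub>2 * (?I n * \<Gamma> (1, 1) / (1 - gap \<sigma>))) \<longlonglongrightarrow> C\<^sub>2 * (0 * \<Gamma> (1, 1) / (1 - gap \<sigma>))"
    using gap by (intro tendsto_intros e_int) simp
  then have "\<forall>\<^sub>F n in sequentially. C\<^sub>2 * (?I n * \<Gamma> (1, 1) / (1 - gap \<sigma>)) < \<epsilon>"
    using \<epsilon> by (intro order_tendstoD(2)[of _ 0]) auto
  then obtain n where n: "C\<^sub>2 * (?I n * \<Gamma> (1, 1) / (1 - gap \<sigma>)) < \<epsilon>"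
    by (auto simp: eventually_sequentially)
  \<comment> \<open>At time \<open>\<tau>\<close> the weight equals one, so the weighted bound is a
    bound on the norm.\<close>
  have "norm (dq (u n) (s n) (h n) \<tau> - dq (v n) (t n) (h n) \<tau>) \<le>
      C\<^sub>2 * (?I n * \<Gamma> (1, 1) / (1 - gap \<sigma>)) * exp (\<sigma> * (\<tau> - \<tau>))"
    by (rule exp_bounded_norm[OF dq_diff_bound[OF nz(1) nz(2) e_def e_int(1) order_refl] order_refl])
  also have "\<dots> < \<epsilon>" using n by simp
  finally show False using *[of n] by simp
qed

end

text \<open>The orbits are constructed with \<open>\<sigma>'\<close>, and after weakening the bound
  they are the backward orbits for \<open>\<sigma>\<close>. The projection is linear and bounded, so
  it commutes with difference quotients and preserves their Cauchy property.\<close>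

lemma manifold_map_C1:
  fixes Df :: "real \<Rightarrow> 'a \<Rightarrow> 'a \<Rightarrow>\<^sub>L 'a"
  assumes \<sigma>: "\<rho> < \<sigma>" "\<sigma> < \<gamma>" and gap: "gap \<sigma> < 1"
    and der: "\<And>t u. (f t has_derivative blinfun_apply (Df t u)) (at u)"
    and Df: "\<And>t u0. ((\<lambda>u. norm (Df t u - Df t u0)) \<longlongrightarrow> 0) (at u0)"
  shows "\<exists>D :: 'a \<Rightarrow> 'a \<Rightarrow>\<^sub>L 'a. \<forall>\<eta>.
      (manifold_map L Q \<gamma> \<rho> \<Gamma> f \<sigma> \<tau> has_derivative blinfun_apply (D \<eta>)) (at \<eta>) \<and>
      ((\<lambda>h. D (\<eta> + h)) \<longlongrightarrow> D \<eta>) (at 0)"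
proof -
  obtain \<sigma>' where \<sigma>': "\<rho> < \<sigma>'" "\<sigma>' < \<sigma>" and gap': "gap \<sigma>' < 1"
    by (rule gap_below[OF \<sigma> gap])
  have \<sigma>'\<gamma>: "\<sigma>' < \<gamma>" using \<sigma>' \<sigma> by simp
  have "\<exists>z. orbit \<tau> \<eta> z \<and> (\<exists>c. exp_bounded \<sigma>' \<tau> c z)" for \<eta>
    using orbit_exists[OF \<sigma>'(1) \<sigma>'\<gamma> gap'] by metis
  then obtain zz where zz: "\<And>\<eta>. orbit \<tau> \<eta> (zz \<eta>)" "\<And>\<eta>. \<exists>c. exp_bounded \<sigma>' \<tau> c (zz \<eta>)"
    by metis
  note ctx = \<sigma>' \<sigma>(2) gap gap' zz
  let ?\<Pi> = "id_blinfun - Q \<tau>"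
  have mm: "manifold_map L Q \<gamma> \<rho> \<Gamma> f \<sigma> \<tau> \<eta> = ?\<Pi> (zz \<eta> \<tau>)" for \<eta>
  proof -
    obtain c where "exp_bounded \<sigma>' \<tau> c (zz \<eta>)" using zz by blast
    from exp_bounded_weaken[OF this less_imp_le[OF \<sigma>'(2)]] have "exp_bounded \<sigma> \<tau> c (zz \<eta>)" .
    from backward_orbit_eq[OF \<sigma> gap zz(1) this] show ?thesis by (simp add: manifold_map_def)
  qed
  show ?thesis
  proof (rule C1_if_difference_quotients_Cauchy[where C="norm ?\<Pi> * (C\<^sub>2 * C\<^sub>1 / (1 - gap \<sigma>'))"])
    fix u v
    have "norm (zz u \<tau> - zz v \<tau>) \<le> C\<^sub>2 * C\<^sub>1 / (1 - gap \<sigma>') * norm (u - v)"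
      using exp_bounded_norm[OF zz_diff_bound[OF ctx] order_refl, of u v] by simp
    from order_trans[OF norm_blinfun mult_left_mono[OF this norm_ge_zero]]
    show "norm (manifold_map L Q \<gamma> \<rho> \<Gamma> f \<sigma> \<tau> u - manifold_map L Q \<gamma> \<rho> \<Gamma> f \<sigma> \<tau> v) \<le>
        norm ?\<Pi> * (C\<^sub>2 * C\<^sub>1 / (1 - gap \<sigma>')) * norm (u - v)"
      unfolding mm blinfun.diff_right[symmetric] mult.assoc .
  next
    fix \<eta> :: 'a and B \<epsilon> :: real assume \<epsilon>: "\<epsilon> > 0"
    \<comment> \<open>The summand 1 keeps the divisor positive when the projection vanishes.\<close>
    let ?p = "norm ?\<Pi> + 1"
    have p: "?p > 0" using norm_ge_zero[of ?\<Pi>] by linarith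
    obtain d where d: "d > 0" "\<And>u v h s t. norm (u - \<eta>) < d \<Longrightarrow> norm (v - \<eta>) < d \<Longrightarrow>
      s \<noteq> 0 \<Longrightarrow> \<bar>s\<bar> < d \<Longrightarrow> t \<noteq> 0 \<Longrightarrow> \<bar>t\<bar> < d \<Longrightarrow> norm h \<le> B \<Longrightarrow>
      norm (dq zz u s h \<tau> - dq zz v t h \<tau>) \<le> \<epsilon> / ?p"
      using dq_Cauchy[OF ctx der Df divide_pos_pos[OF \<epsilon> p], of \<eta> B] by blast
    let ?m = "manifold_map L Q \<gamma> \<rho> \<Gamma> f \<sigma> \<tau>"
    have "norm ((?m (u + s *\<^sub>R h) - ?m u) /\<^sub>R s - (?m (v + t *\<^sub>R h) - ?m v) /\<^sub>R t) \<le> \<epsilon>"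
      if "norm (u - \<eta>) < d" "norm (v - \<eta>) < d" "s \<noteq> 0" "\<bar>s\<bar> < d" "t \<noteq> 0" "\<bar>t\<bar> < d" "norm h \<le> B"
      for u v h s t
    proof -
      have "(?m (u + s *\<^sub>R h) - ?m u) /\<^sub>R s - (?m (v + t *\<^sub>R h) - ?m v) /\<^sub>R t =
          ?\<Pi> (dq zz u s h \<tau> - dq zz v t h \<tau>)"
        unfolding mm dq_def[OF ctx] blinfun.diff_right[symmetric] blinfun.scaleR_right[symmetric] ..
      then have "norm ((?m (u + s *\<^sub>R h) - ?m u) /\<^sub>R s - (?m (v + t *\<^sub>R h) - ?m v) /\<^sub>R t) \<le>
          norm ?\<Pi> * norm (dq zz u s h \<tau> - dq zz v t h \<tau>)"
        by (simp only: norm_blinfun)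
      also have "\<dots> \<le> ?p * (\<epsilon> / ?p)"
        using d(2)[OF that] by (intro mult_mono) auto
      finally show ?thesis using p by simp
    qed
    with d(1) show "\<exists>d>0. \<forall>u v h s t. norm (u - \<eta>) < d \<longrightarrow> norm (v - \<eta>) < d \<longrightarrow> s \<noteq> 0 \<longrightarrow>
        \<bar>s\<bar> < d \<longrightarrow> t \<noteq> 0 \<longrightarrow> \<bar>t\<bar> < d \<longrightarrow> norm h \<le> B \<longrightarrow>
        norm ((?m (u + s *\<^sub>R h) - ?m u) /\<^sub>R s - (?m (v + t *\<^sub>R h) - ?m v) /\<^sub>R t) \<le> \<epsilon>"
      by blast
  qed
qed

end

theorem theorem6p1:
  fixes L :: "real \<Rightarrow> real \<Rightarrow> ('a::banach) \<Rightarrow>\<^sub>L 'a"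
    and Q :: "real \<Rightarrow> 'a \<Rightarrow>\<^sub>L 'a"
    and M \<gamma> \<rho> \<sigma> L1 L2 :: real
    and \<Gamma> :: "real \<times> real \<Rightarrow> real"
    and f :: "real \<Rightarrow> 'a \<Rightarrow> 'a"
    and T :: "real \<Rightarrow> real \<Rightarrow> 'a \<Rightarrow> 'a"
    and Df :: "real \<Rightarrow> 'a \<Rightarrow> 'a \<Rightarrow>\<^sub>L 'a"
  assumes "linear_evolution_process L"
    and "exponential_splitting L Q M \<gamma> \<rho>"
    and "admissible_norm \<Gamma>"
    and "continuous_on UNIV (\<lambda>(t, u). f t u)"
    and "\<And>t. f t 0 = 0"
    and "L1 > 0" and "L2 > 0"
    and "lipschitz_conditions L Q \<gamma> \<rho> \<Gamma> f L1 L2"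
    and "evolution_process T"
    and "variation_of_constants L f T"
    and "\<rho> < \<sigma>" and "\<sigma> < \<gamma>"
    and "\<Gamma> (L1 / (\<sigma> - \<rho>), L2 / (\<gamma> - \<sigma>)) < 1"
    and "\<And>t u. (f t has_derivative blinfun_apply (Df t u)) (at u)"
    and "\<And>t u0. ((\<lambda>u. norm (Df t u - Df t u0)) \<longlongrightarrow> 0) (at u0)"
  shows "\<exists>D\<Sigma> :: real \<Rightarrow> 'a \<Rightarrow> 'a \<Rightarrow>\<^sub>L 'a. \<forall>\<tau> \<eta>.
           (manifold_map L Q \<gamma> \<rho> \<Gamma> f \<sigma> \<tau> has_derivative blinfun_apply (D\<Sigma> \<tau> \<eta>)) (at \<eta>) \<and>
           ((\<lambda>h. D\<Sigma> \<tau> (\<eta> + h)) \<longlongrightarrow> D\<Sigma> \<tau> \<eta>) (at 0)"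
proof -
  interpret lipschitz_perturbation L Q M \<gamma> \<rho> \<Gamma> f L1 L2
    by (unfold_locales; fact assms)
  have "gap \<sigma> < 1"
    unfolding gap_def by fact
  have "\<exists>D :: 'a \<Rightarrow> 'a \<Rightarrow>\<^sub>L 'a. \<forall>\<eta>.
      (manifold_map L Q \<gamma> \<rho> \<Gamma> f \<sigma> \<tau> has_derivative blinfun_apply (D \<eta>)) (at \<eta>) \<and>
      ((\<lambda>h. D (\<eta> + h)) \<longlongrightarrow> D \<eta>) (at 0)" for \<tau>
    by (rule manifold_map_C1) fact+
  then show ?thesis
    by (intro choice allI)
qed

end
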